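(* Let $s\in\mathbb{R}$. (i) For $0<q_1\le q_0\le\infty$: $\mathbf{B}^{s,q_1}_p(AB)\hookrightarrow\mathbf{B}^{s,q_0}_p(AB)$ for $0<p\le\infty$, and $\mathbf{F}^{s,q_1}_p(AB)\hookrightarrow\mathbf{F}^{s,q_0}_p(AB)$ for $0<p<\infty$. (ii) For $0<q_0\le\infty$, $0<q_1\le\infty$ and $\varepsilon>\frac{d-1}{(d+1)q_0}$: $\mathbf{B}^{s+\varepsilon,q_1}_p(AB)\hookrightarrow\mathbf{B}^{s,q_0}_p(AB)$ for $0<p\le\infty$, and $\mathbf{F}^{s+\varepsilon,q_1}_p(AB)\hookrightarrow\mathbf{F}^{s,q_0}_p(AB)$ for $0<p<\infty$. (iii) For $0<q\le\infty$ and $0<p<\infty$: $$\mathbf{B}^{s,\min\{p,q\}}_p(AB)\hookrightarrow\mathbf{F}^{s,q}_p(AB)\hookrightarrow\mathbf{B}^{s,\max\{p,q\}}_p(AB).$$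
   Context: $X\hookrightarrow Y$ means $X\subset Y$ and $\|f\|_Y\le C\|f\|_X$ for all $f\in X$. Let $d\ge2$. Frequency vectors $\xi\in\hat{\mathbb{R}}^d$ are row vectors, and $\hat g(\xi)=\int_{\mathbb{R}^d}g(x)e^{-2\pi i\xi x}dx$. $\mathcal{S}'$ is the space of tempered distributions on $\mathbb{R}^d$. Shearlets. Fix $\hat\psi_1,\hat\psi_2\in C^\infty(\mathbb{R})$ with $\operatorname{supp}\hat\psi_1\subset[-\frac12,-\frac1{16}]\cup[\frac1{16},\frac12]$, $\operatorname{supp}\hat\psi_2\subset[-1,1]$, $\sum_{j\ge0}|\hat\psi_1(2^{-2j}\omega)|^2=1$ for $|\omega|\ge\frac18$, and $|\hat\psi_2(\omega-1)|^2+|\hat\psi_2(\omega)|^2+|\hat\psi_2(\omega+1)|^2=1$ for $|\omega|\le1$. For $\mathfrak d=1,\dots,d$ let $\hat\psi^{(\mathfrak d)}(\xi)=\hat\psi_1(\xi_{\mathfrak d})\prod_{i\ne\mathfrak d}\hat\psi_2(\xi_i/\xi_{\mathfrak d})$. Let $A_{(\mathfrak d)}$ be the diagonal $d\times d$ matrix with entry $4$ in position $\mathfrak d$ and $2$ elsewhere. For $\ell=(\ell_1,\dots,\ell_{d-1})\in\mathbb{Z}^{d-1}$ let $B^{[\ell]}_{(\mathfrak d)}$ be the identity matrix with the off-diagonal entries of row $\mathfrak d$ replaced, in order, by $\ell_1,\dots,\ell_{d-1}$; its inverse is $B^{[-\ell]}_{(\mathfrak d)}$. Write $|[\ell]|\preceq2^j$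 if $|\ell_i|\le2^j$ for all $i$. For an invertible matrix $M$, $\psi_M(x)=|\det M|^{-1}\psi(M^{-1}x)$, and $\tilde\psi(x)=\overline{\psi(-x)}$. Let $\hat\Psi\in C_c^\infty(\hat{\mathbb{R}}^d)$ with $\operatorname{supp}\hat\Psi\subset[-\frac14,\frac14]^d$ and $|\hat\Psi|=1$ on $\mathcal R=[-\frac18,\frac18]^d$ be such that for all $\xi$ $$|\hat\Psi(\xi)|^2\chi_{\mathcal R}(\xi)+\sum_{\mathfrak d=1}^d\sum_{j\ge0}\sum_{|[\ell]|\preceq2^j}|\hat\psi^{(\mathfrak d)}(\xi A^{-j}_{(\mathfrak d)}B^{[-\ell]}_{(\mathfrak d)})|^2\chi_{\mathcal D^{(\mathfrak d)}}(\xi)=1,$$ where $\mathcal D^{(\mathfrak d)}=\{\xi:|\xi_{\mathfrak d}|\ge\frac18,\ |\xi_i/\xi_{\mathfrak d}|\le1\ (i\ne\mathfrak d)\}$. Put $|Q_j|=2^{-(d+1)j}$. Spaces. For $\alpha\in\mathbb{R}$, $0<p,q\le\infty$, $\mathbf{B}^{\alpha,q}_p(AB)$ is the set of $f\in\mathcal{S}'$ with $$\|f\|_{\mathbf{B}^{\alpha,q}_p(AB)}=\|f*\Psi\|_{L^p}+\Big(\sum_{\mathfrak d=1}^d\sum_{j\ge0}\sum_{|[\ell]|\preceq2^j}\big[|Q_j|^{-\alpha}\|f*\psi^{(\mathfrak d)}_{A^{-j}_{(\mathfrak d)}B^{[-\ell]}_{(\mathfrak d)}}\|_{L^p}\big]^q\Big)^{1/q}<\infty.$$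 For $\alpha\in\mathbb{R}$, $0<p<\infty$, $0<q\le\infty$, $\mathbf{F}^{\alpha,q}_p(AB)$ is the set of $f\in\mathcal{S}'$ with $$\|f\|_{\mathbf{F}^{\alpha,q}_p(AB)}=\|f*\Psi\|_{L^p}+\Big\|\Big(\sum_{\mathfrak d=1}^d\sum_{j\ge0}\sum_{|[\ell]|\preceq2^j}\big[|Q_j|^{-\alpha}|\tilde\psi^{(\mathfrak d)}_{A^{-j}_{(\mathfrak d)}B^{[-\ell]}_{(\mathfrak d)}}*f|\big]^q\Big)^{1/q}\Big\|_{L^p}<\infty$$ (usual supremum modification when $q=\infty$). The paper regards these spaces as independent of the particular admissible choice of $\psi$ (in particular $\psi$ may be replaced by $\tilde\psi$ in either definition).
   Formalization: The tiling identity for Ψ and the shearlets is required for almost every ξ, since for all ξ it fails (at ξ=(1/8,0,…,0) the sum is 2); in (iii) both spaces use the same window family, either ψ or ψ̃, as the stated independence of this choice allows. *)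

theory Defs
  imports "HOL-Analysis.Analysis" "HOL-Probability.Essential_Supremum"
begin

section \<open>Smooth functions, Schwartz functions, tempered distributions\<close>

text \<open>For a list \<open>vs\<close> of basis vectors, \<open>iter_deriv vs f\<close> is the corresponding iterated partial
  derivative. If all of these are (Frechet) differentiable everywhere, then \<open>f\<close> is of class
  \<open>C\<^sup>\<infinity>\<close>, and conversely.\<close>

primrec iter_deriv :: "'a::euclidean_space list \<Rightarrow> ('a \<Rightarrow> complex) \<Rightarrow> 'a \<Rightarrow> complex" where
  "iter_deriv [] f = f"
| "iter_deriv (v # vs) f = (\<lambda>x. frechet_derivative (iter_deriv vs f) (at x) v)"

definition smooth :: "('a::euclidean_space \<Rightarrow> complex) \<Rightarrow> bool" where
  "smooth f \<longleftrightarrow> (\<forall>vs\<in>lists Basis. \<forall>x. iter_deriv vs f differentiable (at x))"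

definition schwartz :: "('a::euclidean_space \<Rightarrow> complex) \<Rightarrow> bool" where
  "schwartz f \<longleftrightarrow> smooth f \<and>
     (\<forall>k. \<forall>vs\<in>lists Basis. bdd_above (range (\<lambda>x. (1 + norm x) ^ k * cmod (iter_deriv vs f x))))"

definition schwartz_seminorm ::
    "nat \<Rightarrow> 'a::euclidean_space list \<Rightarrow> ('a \<Rightarrow> complex) \<Rightarrow> real" where
  "schwartz_seminorm k vs f = (SUP x. (1 + norm x) ^ k * cmod (iter_deriv vs f x))"

definition schwartz_tendsto ::
    "(nat \<Rightarrow> 'a::euclidean_space \<Rightarrow> complex) \<Rightarrow> ('a \<Rightarrow> complex) \<Rightarrow> bool" where
  "schwartz_tendsto F g \<longleftrightarrow>
     (\<forall>k. \<forall>vs\<in>lists Basis. (\<lambda>n. schwartz_seminorm k vs (\<lambda>x. F n x - g x)) \<longlonglongrightarrow> 0)"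

text \<open>Complex linear functionals on the Schwartz space, continuous for its (metrizable) topology.
  Extensionality outside the Schwartz space makes equality of functionals the usual one.\<close>

definition tempered :: "(('a::euclidean_space \<Rightarrow> complex) \<Rightarrow> complex) set" where
  "tempered = {f.
     f \<in> extensional {\<phi>. schwartz \<phi>} \<and>
     (\<forall>\<phi> \<eta>. schwartz \<phi> \<longrightarrow> schwartz \<eta> \<longrightarrow> f (\<lambda>x. \<phi> x + \<eta> x) = f \<phi> + f \<eta>) \<and>
     (\<forall>c \<phi>. schwartz \<phi> \<longrightarrow> f (\<lambda>x. c * \<phi> x) = c * f \<phi>) \<and>
     (\<forall>F \<phi>. (\<forall>n. schwartz (F n)) \<longrightarrow> schwartz \<phi> \<longrightarrow> schwartz_tendsto F \<phi> \<longrightarrow>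
        (\<lambda>n. f (F n)) \<longlonglongrightarrow> f \<phi>)}"

definition dconv :: "(('a::euclidean_space \<Rightarrow> complex) \<Rightarrow> complex) \<Rightarrow> ('a \<Rightarrow> complex) \<Rightarrow> 'a \<Rightarrow> complex" where
  "dconv f \<phi> x = f (\<lambda>y. \<phi> (x - y))"

definition fourier :: "('a::euclidean_space \<Rightarrow> complex) \<Rightarrow> 'a \<Rightarrow> complex" where
  "fourier g \<xi> =
     (LINT x|lborel. g x * exp (- (2 * of_real pi * \<i> * of_real (\<xi> \<bullet> x))))"

definition supp :: "('a::euclidean_space \<Rightarrow> complex) \<Rightarrow> 'a set" where
  "supp f = closure {x. f x \<noteq> 0}"


section \<open>Quasi-norms\<close>

definition ennpowr :: "ennreal \<Rightarrow> real \<Rightarrow> ennreal" where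
  "ennpowr x r = (if x = \<infinity> then \<infinity> else ennreal (enn2real x powr r))"
  \<comment> \<open>only used for \<open>r > 0\<close>\<close>

definition Lp_norm :: "ennreal \<Rightarrow> ('a::euclidean_space \<Rightarrow> ennreal) \<Rightarrow> ennreal" where
  "Lp_norm p g =
     (if p = \<infinity> then esssup lborel g
      else ennpowr (\<integral>\<^sup>+x. ennpowr (g x) (enn2real p) \<partial>lborel) (1 / enn2real p))"

definition lq_norm :: "ennreal \<Rightarrow> 'i set \<Rightarrow> ('i \<Rightarrow> ennreal) \<Rightarrow> ennreal" where
  "lq_norm q I a =
     (if q = \<infinity> then (SUP i\<in>I. a i)
      else ennpowr (\<integral>\<^sup>+i. ennpowr (a i) (enn2real q) \<partial>count_space I) (1 / enn2real q))"


section \<open>Shearlets\<close>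

text \<open>The dimension is \<open>d = CARD('n)\<close>. Shear parameters in \<open>\<int>\<^sup>d\<^sup>-\<^sup>1\<close> are represented by
  \<open>l :: int^'n\<close> with \<open>l $ dd = 0\<close>, that is, they are indexed directly by the positions of the
  off-diagonal entries of row \<open>dd\<close>. Frequency vectors act from the left, \<open>\<xi> v* M\<close>.\<close>

definition dilation_mat :: "'n::finite \<Rightarrow> real^'n^'n" where
  "dilation_mat dd = (\<chi> i k. if i = k then (if i = dd then 4 else 2) else 0)"

definition shear_mat :: "'n::finite \<Rightarrow> int^'n \<Rightarrow> real^'n^'n" where
  "shear_mat dd l = (\<chi> i k. if i = k then 1 else if i = dd then real_of_int (l $ k) else 0)"

primrec mat_power :: "real^'n^'n \<Rightarrow> nat \<Rightarrow> real^'n::finite^'n" where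
  "mat_power M 0 = mat 1"
| "mat_power M (Suc k) = M ** mat_power M k"

text \<open>The matrix \<open>A\<^sup>-\<^sup>jB\<^sup>[\<^sup>-\<^sup>l\<^sup>]\<close>.\<close>

definition shearlet_mat :: "'n::finite \<Rightarrow> nat \<Rightarrow> int^'n \<Rightarrow> real^'n^'n" where
  "shearlet_mat dd j l = matrix_inv (mat_power (dilation_mat dd) j) ** shear_mat dd (- l)"

definition shearlet_index :: "('n::finite \<times> nat \<times> (int^'n)) set" where
  "shearlet_index = {(dd, j, l). l $ dd = 0 \<and> (\<forall>i. \<bar>l $ i\<bar> \<le> 2 ^ j)}"

definition dilate :: "real^'n::finite^'n \<Rightarrow> (real^'n \<Rightarrow> complex) \<Rightarrow> real^'n \<Rightarrow> complex" where
  "dilate M \<psi> x = of_real (inverse \<bar>det M\<bar>) * \<psi> (matrix_inv M *v x)"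

definition refl_conj :: "('a::euclidean_space \<Rightarrow> complex) \<Rightarrow> 'a \<Rightarrow> complex" where
  "refl_conj \<psi> x = cnj (\<psi> (- x))"

definition shearlet_windows :: "(real \<Rightarrow> complex) \<Rightarrow> (real \<Rightarrow> complex) \<Rightarrow> bool" where
  "shearlet_windows h1 h2 \<longleftrightarrow>
     smooth h1 \<and> smooth h2 \<and>
     supp h1 \<subseteq> {-1/2..-1/16} \<union> {1/16..1/2} \<and>
     supp h2 \<subseteq> {-1..1} \<and>
     (\<forall>\<omega>. \<bar>\<omega>\<bar> \<ge> 1/8 \<longrightarrow> (\<lambda>j. (cmod (h1 (\<omega> / 2 ^ (2 * j))))\<^sup>2) sums 1) \<and>
     (\<forall>\<omega>. \<bar>\<omega>\<bar> \<le> 1 \<longrightarrow>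
        (cmod (h2 (\<omega> - 1)))\<^sup>2 + (cmod (h2 \<omega>))\<^sup>2 + (cmod (h2 (\<omega> + 1)))\<^sup>2 = 1)"

text \<open>Where \<open>\<xi> $ dd = 0\<close> the first factor vanishes, so the value of the quotient is irrelevant.\<close>

definition shearlet_hat ::
    "(real \<Rightarrow> complex) \<Rightarrow> (real \<Rightarrow> complex) \<Rightarrow> 'n::finite \<Rightarrow> real^'n \<Rightarrow> complex" where
  "shearlet_hat h1 h2 dd \<xi> = h1 (\<xi> $ dd) * (\<Prod>i\<in>UNIV - {dd}. h2 (\<xi> $ i / \<xi> $ dd))"

definition low_box :: "(real^'n::finite) set" where
  "low_box = {\<xi>. \<forall>i. \<bar>\<xi> $ i\<bar> \<le> 1/8}"

definition freq_cone :: "'n::finite \<Rightarrow> (real^'n) set" where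
  "freq_cone dd = {\<xi>. \<bar>\<xi> $ dd\<bar> \<ge> 1/8 \<and> (\<forall>i. i \<noteq> dd \<longrightarrow> \<bar>\<xi> $ i / \<xi> $ dd\<bar> \<le> 1)}"

text \<open>\<open>\<psi> dd\<close> and \<open>\<Psi>\<close> are the Schwartz functions with the prescribed Fourier transforms (which are
  smooth and compactly supported). The resolution of the identity is an identity almost everywhere:
  the closed sets \<open>low_box\<close> and \<open>freq_cone dd\<close> overlap on null sets, where the sum with the
  indicator functions counts the value 1 several times.\<close>

definition shearlet_system ::
    "(real \<Rightarrow> complex) \<Rightarrow> (real \<Rightarrow> complex) \<Rightarrow> ('n::finite \<Rightarrow> real^'n \<Rightarrow> complex) \<Rightarrow>
     (real^'n \<Rightarrow> complex) \<Rightarrow> bool" where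
  "shearlet_system h1 h2 \<psi> \<Psi> \<longleftrightarrow>
     shearlet_windows h1 h2 \<and>
     (\<forall>dd. schwartz (\<psi> dd) \<and> fourier (\<psi> dd) = shearlet_hat h1 h2 dd) \<and>
     schwartz \<Psi> \<and>
     smooth (fourier \<Psi>) \<and>
     supp (fourier \<Psi>) \<subseteq> {\<xi>. \<forall>i. \<bar>\<xi> $ i\<bar> \<le> 1/4} \<and>
     (\<forall>\<xi>\<in>low_box. cmod (fourier \<Psi> \<xi>) = 1) \<and>
     (AE \<xi> in lborel.
        ((\<lambda>(dd, j, l). (cmod (fourier (\<psi> dd) (\<xi> v* shearlet_mat dd j l)))\<^sup>2
             * indicator (freq_cone dd) \<xi>)
          has_sum (1 - (cmod (fourier \<Psi> \<xi>))\<^sup>2 * indicator low_box \<xi>)) shearlet_index)"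


section \<open>The spaces\<close>

definition Q_measure :: "'n::finite itself \<Rightarrow> nat \<Rightarrow> real" where
  "Q_measure _ j = 2 powr (- (real CARD('n) + 1) * real j)"

text \<open>In both quasi-norms \<open>\<phi>\<close> is the analysing family. The Besov spaces are defined with
  \<open>\<phi> = \<psi>\<close> and the Triebel-Lizorkin spaces with \<open>\<phi> dd = refl_conj (\<psi> dd)\<close>, but the two choices
  are treated as interchangeable in either definition.\<close>

definition besov_norm ::
    "('n::finite \<Rightarrow> real^'n \<Rightarrow> complex) \<Rightarrow> (real^'n \<Rightarrow> complex) \<Rightarrow> real \<Rightarrow> ennreal \<Rightarrow> ennreal \<Rightarrow>
     ((real^'n \<Rightarrow> complex) \<Rightarrow> complex) \<Rightarrow> ennreal" where
  "besov_norm \<phi> \<Psi> \<alpha> p q f =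
     Lp_norm p (\<lambda>x. ennreal (cmod (dconv f \<Psi> x))) +
     lq_norm q shearlet_index (\<lambda>(dd, j, l).
       ennreal (Q_measure TYPE('n) j powr (- \<alpha>)) *
       Lp_norm p (\<lambda>x. ennreal (cmod (dconv f (dilate (shearlet_mat dd j l) (\<phi> dd)) x))))"

definition triebel_lizorkin_norm ::
    "('n::finite \<Rightarrow> real^'n \<Rightarrow> complex) \<Rightarrow> (real^'n \<Rightarrow> complex) \<Rightarrow> real \<Rightarrow> ennreal \<Rightarrow> ennreal \<Rightarrow>
     ((real^'n \<Rightarrow> complex) \<Rightarrow> complex) \<Rightarrow> ennreal" where
  "triebel_lizorkin_norm \<phi> \<Psi> \<alpha> p q f =
     Lp_norm p (\<lambda>x. ennreal (cmod (dconv f \<Psi> x))) +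
     Lp_norm p (\<lambda>x. lq_norm q shearlet_index (\<lambda>(dd, j, l).
       ennreal (Q_measure TYPE('n) j powr (- \<alpha>)) *
       ennreal (cmod (dconv f (dilate (shearlet_mat dd j l) (\<phi> dd)) x))))"

text \<open>The subspace of tempered distributions on which a quasi-norm is finite, and continuous
  embeddings between such spaces.\<close>

definition qn_space ::
    "((('a::euclidean_space \<Rightarrow> complex) \<Rightarrow> complex) \<Rightarrow> ennreal) \<Rightarrow> (('a \<Rightarrow> complex) \<Rightarrow> complex) set" where
  "qn_space N = {f \<in> tempered. N f < \<infinity>}"

definition embeds ::
    "((('a::euclidean_space \<Rightarrow> complex) \<Rightarrow> complex) \<Rightarrow> ennreal) \<Rightarrow>
     ((('a \<Rightarrow> complex) \<Rightarrow> complex) \<Rightarrow> ennreal) \<Rightarrow> bool" (infix "\<hookrightarrow>" 50) where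
  "NX \<hookrightarrow> NY \<longleftrightarrow>
     qn_space NX \<subseteq> qn_space NY \<and> (\<exists>C::real. \<forall>f\<in>qn_space NX. NY f \<le> ennreal C * NX f)"

end

theory Submission
  imports Defs
begin

text \<open>
  Parts (i) and (ii) reduce to inequalities between \<open>l\<^sup>q\<close> quasi-norms of one and the same
  sequence. These decrease in \<open>q\<close>; and since there are at most a constant times \<open>2\<^bsup>(d-1)j\<^esup>\<close>
  shearlets of scale \<open>j\<close>, the weights \<open>|Q\<^sub>j|\<^bsup>\<epsilon>\<^esup> = 2\<^bsup>-(d+1)j\<epsilon>\<^esup>\<close> have a finite quasi-norm for the
  exponent \<open>q\<^sub>0\<close> as soon as \<open>\<epsilon> > (d-1)/((d+1)q\<^sub>0)\<close>. Part (iii) is Minkowski's integral inequality for the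
  product of Lebesgue and counting measure, with exponent \<open>p/q\<close> or \<open>q/p\<close>, combined with monotonicity
  in \<open>q\<close>. Only here the coefficients \<open>f * \<psi>\<close> have to be measurable; they are continuous, because
  translation is continuous on the Schwartz space.
\<close>

section \<open>Powers and Minkowski's inequality\<close>

lemma ennpowr_simps [simp]: "ennpowr \<infinity> r = \<infinity>" "ennpowr 0 r = 0" "ennpowr x 1 = x"
  "0 \<le> a \<Longrightarrow> ennpowr (ennreal a) r = ennreal (a powr r)"
  by (auto simp: ennpowr_def less_top)

lemma ennpowr_top [simp]: "ennpowr top r = top"
  using ennpowr_simps(1) by simp

lemma ennpowr_mono: "r > 0 \<Longrightarrow> x \<le> y \<Longrightarrow> ennpowr x r \<le> ennpowr y r"
  by (cases x; cases y) (auto intro!: ennreal_leI powr_mono2 simp: top_unique)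

lemma ennpowr_ennpowr: "ennpowr (ennpowr x a) b = ennpowr x (a * b)"
  by (cases x) (auto simp: powr_powr)

lemma ennpowr_inverse: "r > 0 \<Longrightarrow> ennpowr (ennpowr x r) (1 / r) = x"
  "r > 0 \<Longrightarrow> ennpowr (ennpowr x (1 / r)) r = x"
  by (auto simp: ennpowr_ennpowr simp del: One_nat_def)

lemma ennpowr_le_iff: "r > 0 \<Longrightarrow> ennpowr x r \<le> y \<longleftrightarrow> x \<le> ennpowr y (1 / r)"
  by (metis ennpowr_inverse ennpowr_mono divide_pos_pos zero_less_one)

lemma ennpowr_eq_0_iff [simp]: "ennpowr x r = 0 \<longleftrightarrow> x = 0"
  by (cases x) auto

lemma ennpowr_eq_top_iff [simp]: "ennpowr x r = top \<longleftrightarrow> x = top"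
  by (cases x) auto

lemma ennpowr_mult: "r > 0 \<Longrightarrow> ennpowr (x * y) r = ennpowr x r * ennpowr y r"
proof (cases "x = 0 \<or> y = 0 \<or> x = top \<or> y = top")
  case True
  then show ?thesis
    by (auto simp: ennreal_mult_top ennreal_top_mult ennreal_mult_eq_top_iff)
next
  case False
  then show ?thesis
    by (cases x; cases y) (auto simp: powr_mult simp flip: ennreal_mult)
qed

lemma ennpowr_add: "a > 0 \<Longrightarrow> b > 0 \<Longrightarrow> ennpowr x (a + b) = ennpowr x a * ennpowr x b"
  by (cases x) (auto simp: powr_add simp flip: ennreal_mult)

text \<open>By \<open>ennpowr_le_iff\<close> the powers with exponents r and 1/r are mutually
  inverse monotone maps, and an order isomorphism preserves suprema.\<close>

lemma ennpowr_SUP: "r > 0 \<Longrightarrow> ennpowr (SUP i\<in>I. f i) r = (SUP i\<in>I. ennpowr (f i) r)"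
proof (intro antisym SUP_least ennpowr_mono SUP_upper)
  assume r: "r > 0"
  show "ennpowr (SUP i\<in>I. f i) r \<le> (SUP i\<in>I. ennpowr (f i) r)"
    unfolding ennpowr_le_iff[OF r]
    by (intro SUP_least iffD1[OF ennpowr_le_iff[OF r]] SUP_upper)
qed

lemma measurable_ennpowr [measurable]:
  "f \<in> borel_measurable M \<Longrightarrow> (\<lambda>x. ennpowr (f x) r) \<in> borel_measurable M"
  unfolding ennpowr_def infinity_ennreal_def
  by (intro measurable_If measurable_compose[OF _ measurable_ennreal] powr_real_measurable) auto

section \<open>The inequalities of Young, Hoelder and Minkowski\<close>

text \<open>Young's inequality for x/F and y/G, multiplied by F^a G^b. With F and G the integrals of
  two functions, integrating the right-hand side turns the bracket into a + b = 1.\<close>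

lemma weighted_AM_GM_scaled:
  fixes x y F G :: ennreal
  assumes "a > 0" "b > 0" "a + b = 1" "0 < F" "F < top" "0 < G" "G < top"
  shows "ennpowr x a * ennpowr y b
    \<le> ennpowr F a * ennpowr G b * (ennreal a * (x / F) + ennreal b * (y / G))"
proof (cases "x = top \<or> y = top")
  case True
  with assms show ?thesis
    by (auto simp: ennreal_mult_eq_top_iff ennreal_top_divide ennreal_mult_top)
next
  case False
  obtain x' y' F' G' where e: "x = ennreal x'" "y = ennreal y'" "F = ennreal F'" "G = ennreal G'"
    and n: "0 \<le> x'" "0 \<le> y'" "0 < F'" "0 < G'"
    using False assms by (cases x; cases y; cases F; cases G) auto
  show ?thesis
  proof (cases "x' = 0 \<or> y' = 0")
    case True
    then show ?thesis by (auto simp: e)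
  next
    case f: False
    have "(x'/F') powr a * (y'/G') powr b \<le> a * (x'/F') + b * (y'/G')"
      using assms f n by (intro Youngs_inequality_0) auto
    then have "(F' powr a * G' powr b) * ((x'/F') powr a * (y'/G') powr b)
        \<le> (F' powr a * G' powr b) * (a * (x'/F') + b * (y'/G'))"
      by (intro mult_left_mono) auto
    moreover have "(F' powr a * G' powr b) * ((x'/F') powr a * (y'/G') powr b) = x' powr a * y' powr b"
      using n by (simp add: powr_divide)
    ultimately have "x' powr a * y' powr b \<le> (F' powr a * G' powr b) * (a * (x'/F') + b * (y'/G'))"
      by simp
    then show ?thesis
      using n assms(1,2)
      by (auto simp: e divide_ennreal simp flip: ennreal_mult ennreal_plus intro!: ennreal_leI)
  qed
qed

text \<open>The scaled Young inequality is integrated when both integrals are positive and finite.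
  Otherwise either one of them is 0 and the integrand on the left vanishes almost everywhere, or
  both are nonzero, one is infinite, and the right-hand side is infinite.\<close>

lemma nn_integral_Hoelder:
  assumes [measurable]: "f \<in> borel_measurable M" "g \<in> borel_measurable M"
    and ab: "a > 0" "b > 0" "a + b = 1"
  shows "(\<integral>\<^sup>+x. ennpowr (f x) a * ennpowr (g x) b \<partial>M)
    \<le> ennpowr (\<integral>\<^sup>+x. f x \<partial>M) a * ennpowr (\<integral>\<^sup>+x. g x \<partial>M) b"
proof -
  let ?F = "\<integral>\<^sup>+x. f x \<partial>M" and ?G = "\<integral>\<^sup>+x. g x \<partial>M"
  consider "?F = 0 \<or> ?G = 0" | "?F \<noteq> 0" "?G \<noteq> 0" "?F = top \<or> ?G = top"
    | "0 < ?F" "?F < top" "0 < ?G" "?G < top"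
    by (cases "?F = 0 \<or> ?G = 0"; cases "?F = top \<or> ?G = top")
      (auto simp: zero_less_iff_neq_zero top.not_eq_extremum)
  then show ?thesis
  proof cases
    case 1
    then have "(AE x in M. f x = 0) \<or> (AE x in M. g x = 0)"
      by (auto simp: nn_integral_0_iff_AE)
    then have "AE x in M. ennpowr (f x) a * ennpowr (g x) b = 0"
      by (auto elim: eventually_mono)
    then have "(\<integral>\<^sup>+x. ennpowr (f x) a * ennpowr (g x) b \<partial>M) = 0"
      by (subst nn_integral_0_iff_AE) auto
    then show ?thesis by simp
  next
    case 2
    then show ?thesis by (auto simp: ennreal_mult_top ennreal_top_mult)
  next
    case 3
    let ?C = "ennpowr ?F a * ennpowr ?G b"
    have "(\<integral>\<^sup>+x. ennpowr (f x) a * ennpowr (g x) b \<partial>M)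
        \<le> (\<integral>\<^sup>+x. ?C * (ennreal a * (f x / ?F) + ennreal b * (g x / ?G)) \<partial>M)"
      by (intro nn_integral_mono weighted_AM_GM_scaled 3 ab)
    also have "\<dots> = ?C * (ennreal a * (?F / ?F) + ennreal b * (?G / ?G))"
      by (simp add: nn_integral_cmult nn_integral_add nn_integral_divide)
    also have "\<dots> = ?C"
      using 3 ab by (simp add: ennreal_divide_self less_top flip: ennreal_plus)
    finally show ?thesis .
  qed
qed

text \<open>
  With \<open>G = \<integral> F dy\<close>, Hoelder applied to \<open>\<integral> G K\<^bsup>r-1\<^esup>\<close> bounds \<open>\<integral> K\<^sup>r\<close> for every \<open>K \<le> G\<close>; the truncations
  \<open>K\<close> are needed because the argument divides by a power of \<open>\<integral> K\<^sup>r\<close>, which must be finite.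
\<close>

theorem (in pair_sigma_finite) nn_integral_Minkowski:
  assumes F [measurable]: "(\<lambda>(x, y). F x y) \<in> borel_measurable (M1 \<Otimes>\<^sub>M M2)" and r: "r \<ge> 1"
  shows "ennpowr (\<integral>\<^sup>+x. ennpowr (\<integral>\<^sup>+y. F x y \<partial>M2) r \<partial>M1) (1 / r)
    \<le> (\<integral>\<^sup>+y. ennpowr (\<integral>\<^sup>+x. ennpowr (F x y) r \<partial>M1) (1 / r) \<partial>M2)"
proof (cases "r = 1")
  case True
  \<comment> \<open>For r = 1 the Hoelder exponent 1 - 1/r would be 0; the claim is then Tonelli's
    theorem.\<close>
  then show ?thesis using Fubini'[OF F] by simp
next
  case False
  with r have r: "r > 1" by simp
  define G where "G x = (\<integral>\<^sup>+y. F x y \<partial>M2)" for x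
  define R where "R = (\<integral>\<^sup>+y. ennpowr (\<integral>\<^sup>+x. ennpowr (F x y) r \<partial>M1) (1 / r) \<partial>M2)"
  have G [measurable]: "G \<in> borel_measurable M1"
    unfolding G_def by measurable
  have bound: "(\<integral>\<^sup>+x. ennpowr (K x) r \<partial>M1) \<le> ennpowr R r"
    if [measurable]: "K \<in> borel_measurable M1" and le: "\<And>x. K x \<le> G x"
      and fin: "(\<integral>\<^sup>+x. ennpowr (K x) r \<partial>M1) < top" for K
  proof -
    define A where "A = (\<integral>\<^sup>+x. ennpowr (K x) r \<partial>M1)"
    have "A = (\<integral>\<^sup>+x. K x * ennpowr (K x) (r - 1) \<partial>M1)"
      unfolding A_def using ennpowr_add[of 1 "r - 1"] r by simp
    also have "\<dots> \<le> (\<integral>\<^sup>+x. G x * ennpowr (K x) (r - 1) \<partial>M1)"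
      by (intro nn_integral_mono mult_right_mono le) simp
    also have "\<dots> = (\<integral>\<^sup>+x. \<integral>\<^sup>+y. F x y * ennpowr (K x) (r - 1) \<partial>M2 \<partial>M1)"
      unfolding G_def by (intro nn_integral_cong nn_integral_multc [symmetric]) measurable
    also have "\<dots> = (\<integral>\<^sup>+y. \<integral>\<^sup>+x. F x y * ennpowr (K x) (r - 1) \<partial>M1 \<partial>M2)"
      by (intro Fubini' [symmetric]) measurable
    \<comment> \<open>Since r (1 - 1/r) = r - 1, the integrand takes the form to which Hoelder in x
      applies, with exponents 1/r and 1 - 1/r.\<close>
    also have "\<dots> = (\<integral>\<^sup>+y. \<integral>\<^sup>+x. ennpowr (ennpowr (F x y) r) (1 / r)
        * ennpowr (ennpowr (K x) r) (1 - 1 / r) \<partial>M1 \<partial>M2)"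
      using r by (simp add: ennpowr_ennpowr right_diff_distrib)
    also have "\<dots> \<le> (\<integral>\<^sup>+y. ennpowr (\<integral>\<^sup>+x. ennpowr (F x y) r \<partial>M1) (1 / r) * ennpowr A (1 - 1 / r) \<partial>M2)"
      unfolding A_def using r by (intro nn_integral_mono nn_integral_Hoelder) auto
    also have "\<dots> = R * ennpowr A (1 - 1 / r)"
      unfolding R_def by (intro nn_integral_multc) measurable
    finally have le: "A \<le> R * ennpowr A (1 - 1 / r)" .
    show ?thesis
    proof (cases "A = 0")
      case False
      have "ennpowr A (1 / r) * ennpowr A (1 - 1 / r) \<le> R * ennpowr A (1 - 1 / r)"
        using le r ennpowr_add[of "1 / r" "1 - 1 / r" A] by simp
      \<comment> \<open>The factor A^(1 - 1/r) is neither 0 nor infinite, hence cancels.\<close>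
      then have "ennpowr A (1 / r) \<le> R"
        using False fin A_def
        by (subst (asm) (1 2) mult.commute, subst (asm) ennreal_mult_le_mult_iff) auto
      then show ?thesis
        using r by (simp add: ennpowr_le_iff [of "1 / r", simplified] flip: A_def)
    qed (simp add: A_def)
  qed
  obtain A :: "nat \<Rightarrow> 'a set" where A: "range A \<subseteq> sets M1" "(\<Union>i. A i) = space M1"
    "\<And>i. emeasure M1 (A i) \<noteq> \<infinity>" "incseq A"
    by (rule M1.sigma_finite_incseq) auto
  then have [measurable]: "A n \<in> sets M1" for n by auto
  \<comment> \<open>G is cut off at height n and restricted to a set of finite measure: this makes
    the integral of K^r finite, while the truncations increase to G.\<close>
  define K where "K n x = min (G x) (of_nat n) * indicator (A n) x" for n x
  have [measurable]: "K n \<in> borel_measurable M1" for n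
    unfolding K_def by measurable
  have K_mono: "K m x \<le> K n x" if "m \<le> n" for m n x
  proof -
    have "A m \<subseteq> A n" "(of_nat m :: ennreal) \<le> of_nat n"
      using A(4) that by (auto dest: incseqD)
    then show ?thesis
      unfolding K_def by (intro mult_mono min.mono indicator_leI) auto
  qed
  have "(SUP n. K n x) = G x" if x: "x \<in> space M1" for x
  proof (intro antisym SUP_least)
    show "K n x \<le> G x" for n by (auto simp: K_def indicator_def)
    show "G x \<le> (SUP n. K n x)"
    proof (unfold le_SUP_iff, intro allI impI)
      fix y assume y: "y < G x"
      obtain m where m: "x \<in> A m" using A(2) x by auto
      obtain k where k: "y < of_nat k"
        using y ennreal_Ex_less_of_nat less_top by (metis less_le_trans top_greatest)
      \<comment> \<open>At stage \<open>max m k\<close> the point x lies in the exhausting set and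
        the cut-off height exceeds y.\<close>
      have "x \<in> A (max m k)" using m A(4) by (meson incseqD max.cobounded1 subsetD)
      moreover have "of_nat k \<le> (of_nat (max m k) :: ennreal)" by simp
      ultimately show "\<exists>i\<in>UNIV. y < K i x"
        using y k by (intro bexI[of _ "max m k"]) (auto simp: K_def intro: less_le_trans)
    qed
  qed
  then have "(\<integral>\<^sup>+x. ennpowr (G x) r \<partial>M1) = (\<integral>\<^sup>+x. (SUP n. ennpowr (K n x) r) \<partial>M1)"
    using r by (intro nn_integral_cong) (simp flip: ennpowr_SUP)
  also have "\<dots> = (SUP n. \<integral>\<^sup>+x. ennpowr (K n x) r \<partial>M1)"
    using K_mono r by (intro nn_integral_monotone_convergence_SUP)
      (auto simp: incseq_def le_fun_def intro!: ennpowr_mono)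
  also have "\<dots> \<le> ennpowr R r"
  proof (intro SUP_least bound)
    fix n
    have "ennpowr (K n x) r \<le> ennpowr (of_nat n) r * indicator (A n) x" for x
      using r by (auto simp: K_def indicator_def intro!: ennpowr_mono)
    then have "(\<integral>\<^sup>+x. ennpowr (K n x) r \<partial>M1) \<le> ennpowr (of_nat n) r * emeasure M1 (A n)"
      by (subst nn_integral_cmult_indicator [symmetric]) (auto intro: nn_integral_mono)
    also have "\<dots> < top"
      using A(3)[of n] by (auto simp: less_top [symmetric] ennreal_mult_eq_top_iff)
    finally show "(\<integral>\<^sup>+x. ennpowr (K n x) r \<partial>M1) < top" .
    show "K n x \<le> G x" for x by (auto simp: K_def indicator_def)
  qed simp
  finally show ?thesis
    using r ennpowr_le_iff[of "1 / r"] by (simp flip: R_def G_def)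
qed

section \<open>Mixed quasi-norms\<close>

lemma ennreal_pos_finite_cases:
  assumes "0 < (p::ennreal)" "p < \<infinity>"
  obtains P where "p = ennreal P" "P > 0"
  using assms by (cases p) auto

lemma Lp_norm_ennreal:
  "P > 0 \<Longrightarrow> Lp_norm (ennreal P) g = ennpowr (\<integral>\<^sup>+x. ennpowr (g x) P \<partial>lborel) (1 / P)"
  by (simp add: Lp_norm_def)

lemma lq_norm_ennreal:
  "Q > 0 \<Longrightarrow> lq_norm (ennreal Q) I a = ennpowr (\<integral>\<^sup>+i. ennpowr (a i) Q \<partial>count_space I) (1 / Q)"
  by (simp add: lq_norm_def)

lemma lq_norm_top [simp]: "lq_norm top I a = (SUP i\<in>I. a i)"
  by (simp add: lq_norm_def)

lemma Lp_norm_mono: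
  assumes "0 < p" "p < \<infinity>" "\<And>x. f x \<le> g x"
  shows "Lp_norm p f \<le> Lp_norm p g"
proof -
  obtain P where "p = ennreal P" "P > 0"
    using assms by (elim ennreal_pos_finite_cases)
  then show ?thesis
    using assms(3) by (auto simp: Lp_norm_ennreal intro!: ennpowr_mono nn_integral_mono)
qed

text \<open>No measurability: for an arbitrary \<open>f\<close>, \<open>nn_integral\<close> is the lower integral.\<close>

lemma nn_integral_cmult_le:
  assumes "C > 0"
  shows "(\<integral>\<^sup>+x. ennreal C * f x \<partial>M) \<le> ennreal C * (\<integral>\<^sup>+x. f x \<partial>M)"
proof (subst nn_integral_def, intro SUP_least)
  fix g assume "g \<in> {g. simple_function M g \<and> g \<le> (\<lambda>x. ennreal C * f x)}"
  then have g: "simple_function M g" and le: "\<And>x. g x \<le> ennreal C * f x"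
    by (auto simp: le_fun_def)
  have inv: "ennreal (1 / C) * ennreal C = 1" "ennreal C * ennreal (1 / C) = 1"
    using assms by (auto simp flip: ennreal_mult)
  \<comment> \<open>A simple minorant of C f, divided by C, is a simple minorant of f.\<close>
  have "ennreal (1 / C) * g x \<le> f x" for x
    using mult_left_mono[OF le[of x], of "ennreal (1 / C)"] inv
    by (simp flip: mult.assoc)
  then have "(\<integral>\<^sup>Sx. ennreal (1 / C) * g x \<partial>M) \<le> (\<integral>\<^sup>+x. f x \<partial>M)"
    unfolding nn_integral_def using g by (intro SUP_upper) (auto simp: le_fun_def)
  then have "ennreal (1 / C) * (\<integral>\<^sup>Sx. g x \<partial>M) \<le> (\<integral>\<^sup>+x. f x \<partial>M)"
    using g by (simp add: simple_integral_mult)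
  from mult_left_mono[OF this, of "ennreal C"] inv
  show "(\<integral>\<^sup>Sx. g x \<partial>M) \<le> ennreal C * (\<integral>\<^sup>+x. f x \<partial>M)"
    by (simp flip: mult.assoc)
qed

text \<open>The one-sided bound for the lower integral, used with C and with 1/C, gives equality for
  an arbitrary function g.\<close>

lemma Lp_norm_cmult:
  assumes "0 < p" "p < \<infinity>" "C > 0"
  shows "Lp_norm p (\<lambda>x. ennreal C * g x) = ennreal C * Lp_norm p g"
proof -
  obtain P where P: "p = ennreal P" "P > 0"
    using assms by (elim ennreal_pos_finite_cases)
  have le: "Lp_norm p (\<lambda>x. ennreal C * h x) \<le> ennreal C * Lp_norm p h" if "C > 0" for C h
  proof -
    have "(\<integral>\<^sup>+x. ennpowr (ennreal C * h x) P \<partial>lborel)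
        \<le> ennreal (C powr P) * (\<integral>\<^sup>+x. ennpowr (h x) P \<partial>lborel)"
      using nn_integral_cmult_le[of "C powr P"] that P by (simp add: ennpowr_mult)
    from ennpowr_mono[OF _ this, of "1 / P"] show ?thesis
      using P that by (simp add: Lp_norm_ennreal ennpowr_mult powr_powr)
  qed
  have inv: "ennreal C * ennreal (1 / C) = 1" "ennreal (1 / C) * ennreal C = 1"
    using assms by (auto simp flip: ennreal_mult)
  have "Lp_norm p g \<le> ennreal (1 / C) * Lp_norm p (\<lambda>x. ennreal C * g x)"
    using le[of "1 / C" "\<lambda>x. ennreal C * g x"] assms inv by (simp flip: mult.assoc)
  from mult_left_mono[OF this, of "ennreal C"] inv
  have "ennreal C * Lp_norm p g \<le> Lp_norm p (\<lambda>x. ennreal C * g x)"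
    by (simp flip: mult.assoc)
  with le[OF assms(3)] show ?thesis by (intro antisym)
qed

lemma lq_norm_mono:
  assumes "0 < q" "\<And>i. i \<in> I \<Longrightarrow> a i \<le> b i"
  shows "lq_norm q I a \<le> lq_norm q I b"
proof (cases "q = \<infinity>")
  case True
  then show ?thesis using assms by (auto intro: SUP_mono)
next
  case False
  then obtain Q where "q = ennreal Q" "Q > 0"
    using assms(1) by (elim ennreal_pos_finite_cases) (auto simp: top.not_eq_extremum)
  then show ?thesis
    using assms(2) by (auto simp: lq_norm_ennreal intro!: ennpowr_mono nn_integral_mono)
qed

lemma lq_norm_cmult:
  assumes "0 < q"
  shows "lq_norm q I (\<lambda>i. c * a i) = c * lq_norm q I a"
proof (cases "q = \<infinity>")
  case True
  then show ?thesis by (simp add: SUP_mult_left_ennreal)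
next
  case False
  then obtain Q where "q = ennreal Q" "Q > 0"
    using assms(1) by (elim ennreal_pos_finite_cases) (auto simp: top.not_eq_extremum)
  then show ?thesis
    by (simp add: lq_norm_ennreal ennpowr_mult nn_integral_cmult ennpowr_inverse)
qed

lemma le_lq_norm:
  assumes "0 < q" "i \<in> I"
  shows "a i \<le> lq_norm q I a"
proof (cases "q = \<infinity>")
  case True
  then show ?thesis using assms by (auto intro: SUP_upper)
next
  case False
  then obtain Q where Q: "q = ennreal Q" "Q > 0"
    using assms(1) by (elim ennreal_pos_finite_cases) (auto simp: top.not_eq_extremum)
  have "ennpowr (a i) Q \<le> (\<integral>\<^sup>+i. ennpowr (a i) Q \<partial>count_space I)"
    using nn_integral_ge_point[OF assms(2)] .
  then show ?thesis
    using Q by (simp add: lq_norm_ennreal ennpowr_le_iff)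
qed

text \<open>With N the quasi-norm for the exponent Q1, every term satisfies a_i \<le> N, so a_i^Q0
  \<le> N^(Q0 - Q1) a_i^Q1; summing gives N^Q0. Nothing is divided by N, so N may be 0 or
  infinite.\<close>

lemma lq_norm_antimono:
  assumes "0 < q1" "q1 \<le> q0"
  shows "lq_norm q0 I a \<le> lq_norm q1 I a"
proof (cases "q0 = \<infinity>")
  case True
  then show ?thesis
    by (simp add: SUP_least le_lq_norm[OF assms(1)])
next
  case False
  then have q0: "q0 < \<infinity>"
    by (simp add: top.not_eq_extremum)
  with assms have q0: "0 < q0" "q0 < \<infinity>" "q1 < \<infinity>"
    using less_le_trans[OF assms] le_less_trans[OF assms(2) q0] by simp_all
  obtain Q0 where Q0: "q0 = ennreal Q0" "Q0 > 0"
    using q0 by (elim ennreal_pos_finite_cases)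
  obtain Q1 where Q1: "q1 = ennreal Q1" "Q1 > 0"
    using assms(1) q0(3) by (elim ennreal_pos_finite_cases)
  have "Q1 \<le> Q0"
    using assms(2) Q0 Q1 by simp
  \<comment> \<open>Equality is separate because \<open>ennpowr_add\<close> asks for positive
    exponents: \<open>ennpowr x 0\<close> is not 1 at 0 and at \<open>top\<close>.\<close>
  then consider "Q1 = Q0" | "Q1 < Q0"
    by linarith
  then show ?thesis
  proof cases
    case 1
    then show ?thesis using Q0 Q1 by simp
  next
    case 2
    let ?N = "lq_norm q1 I a"
    have N: "ennpowr ?N Q1 = (\<integral>\<^sup>+i. ennpowr (a i) Q1 \<partial>count_space I)"
      using Q1 by (simp add: lq_norm_ennreal ennpowr_inverse)
    have split: "ennpowr x Q0 = ennpowr x (Q0 - Q1) * ennpowr x Q1" for x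
      using ennpowr_add[of "Q0 - Q1" Q1 x] 2 Q1(2) by simp
    have "(\<integral>\<^sup>+i. ennpowr (a i) Q0 \<partial>count_space I)
        \<le> (\<integral>\<^sup>+i. ennpowr ?N (Q0 - Q1) * ennpowr (a i) Q1 \<partial>count_space I)"
    proof (intro nn_integral_mono)
      fix i assume "i \<in> space (count_space I)"
      then have "a i \<le> ?N"
        using assms(1) by (simp add: le_lq_norm)
      then show "ennpowr (a i) Q0 \<le> ennpowr ?N (Q0 - Q1) * ennpowr (a i) Q1"
        unfolding split using 2 by (intro mult_right_mono ennpowr_mono) simp_all
    qed
    also have "\<dots> = ennpowr ?N Q0"
      unfolding split[of ?N] N by (rule nn_integral_cmult) simp
    finally show ?thesis
      using Q0 by (simp add: lq_norm_ennreal ennpowr_le_iff)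
  qed
qed

section \<open>Interchange of the L^p and l^q quasi-norms\<close>

text \<open>For q \<le> p this is Minkowski for the functions \<open>g i\<close> raised to the power
  Q, with r = P/Q and Lebesgue measure outside. For q > p the inner quasi-norm is first enlarged to
  l^p, where the case of equal exponents applies; hence \<open>min p q\<close>. Countability of I
  makes the counting measure sigma-finite and reduces joint measurability to that of each
  \<open>g i\<close>.\<close>

theorem Lp_norm_lq_norm_le:
  assumes I: "countable I" and g: "\<And>i. i \<in> I \<Longrightarrow> g i \<in> borel_measurable lborel"
    and p: "0 < p" "p < \<infinity>" and q: "0 < q"
  shows "Lp_norm p (\<lambda>x. lq_norm q I (\<lambda>i. g i x)) \<le> lq_norm (min p q) I (\<lambda>i. Lp_norm p (g i))"
proof -
  obtain P where P: "p = ennreal P" "P > 0"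
    using p by (elim ennreal_pos_finite_cases)
  have *: "Lp_norm p (\<lambda>x. lq_norm q I (\<lambda>i. g i x)) \<le> lq_norm q I (\<lambda>i. Lp_norm p (g i))"
    if q: "0 < q" "q \<le> p" for q
  proof -
    obtain Q where Q: "q = ennreal Q" "Q > 0"
      using q(1) le_less_trans[OF q(2) p(2)] by (elim ennreal_pos_finite_cases)
    interpret pair_sigma_finite lborel "count_space I"
      using sigma_finite_measure_count_space_countable[OF I]
      by (simp add: pair_sigma_finite_def sigma_finite_lborel)
    define r where "r = P / Q"
    have r: "r \<ge> 1"
      using q P Q by (auto simp: r_def field_simps)
    have "(\<lambda>(x, i). ennpowr (g i x) Q) \<in> borel_measurable (lborel \<Otimes>\<^sub>M count_space I)"
      unfolding case_prod_beta
      by (rule measurable_compose_countable'[OF _ _ I])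
        (auto intro!: measurable_ennpowr measurable_compose[OF measurable_fst] g)
    from nn_integral_Minkowski[OF this r]
    have "ennpowr (\<integral>\<^sup>+x. ennpowr (\<integral>\<^sup>+i. ennpowr (g i x) Q \<partial>count_space I) r \<partial>lborel) (1 / r)
      \<le> (\<integral>\<^sup>+i. ennpowr (\<integral>\<^sup>+x. ennpowr (ennpowr (g i x) Q) r \<partial>lborel) (1 / r) \<partial>count_space I)" .
    from ennpowr_mono[OF _ this, of "1 / Q"] show ?thesis
      using P Q by (simp add: r_def Lp_norm_ennreal lq_norm_ennreal ennpowr_ennpowr)
  qed
  show ?thesis
  proof (cases "q \<le> p")
    case True
    then show ?thesis using *[OF q] by (simp add: min_absorb2)
  next
    case False
    have "Lp_norm p (\<lambda>x. lq_norm q I (\<lambda>i. g i x)) \<le> Lp_norm p (\<lambda>x. lq_norm p I (\<lambda>i. g i x))"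
      using False p by (intro Lp_norm_mono lq_norm_antimono) auto
    also have "\<dots> \<le> lq_norm p I (\<lambda>i. Lp_norm p (g i))"
      using *[of p] p by simp
    finally show ?thesis using False by (simp add: min_absorb1)
  qed
qed

text \<open>The mirror image: powers P, r = Q/P, and the counting measure outside. At q =
  \<infinity> it suffices that each \<open>g i\<close> lies below the supremum. For q < p the l^p
  quasi-norm is at most the l^q one; hence \<open>max p q\<close>.\<close>

theorem lq_norm_Lp_norm_le:
  assumes I: "countable I" and g: "\<And>i. i \<in> I \<Longrightarrow> g i \<in> borel_measurable lborel"
    and p: "0 < p" "p < \<infinity>" and q: "0 < q"
  shows "lq_norm (max p q) I (\<lambda>i. Lp_norm p (g i)) \<le> Lp_norm p (\<lambda>x. lq_norm q I (\<lambda>i. g i x))"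
proof -
  obtain P where P: "p = ennreal P" "P > 0"
    using p by (elim ennreal_pos_finite_cases)
  have *: "lq_norm q I (\<lambda>i. Lp_norm p (g i)) \<le> Lp_norm p (\<lambda>x. lq_norm q I (\<lambda>i. g i x))"
    if pq: "p \<le> q" for q
  proof (cases "q = \<infinity>")
    case True
    then show ?thesis using p by (auto intro!: SUP_least Lp_norm_mono intro: SUP_upper)
  next
    case False
    obtain Q where Q: "q = ennreal Q" "Q > 0"
      using less_le_trans[OF p(1) pq] False
      by (elim ennreal_pos_finite_cases) (auto simp: top.not_eq_extremum)
    interpret pair_sigma_finite "count_space I" lborel
      using sigma_finite_measure_count_space_countable[OF I]
      by (simp add: pair_sigma_finite_def sigma_finite_lborel)
    define r where "r = Q / P"
    have r: "r \<ge> 1"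
      using pq P Q by (auto simp: r_def field_simps)
    have "(\<lambda>(i, x). ennpowr (g i x) P) \<in> borel_measurable (count_space I \<Otimes>\<^sub>M lborel)"
      by (rule measurable_pair_measure_countable1[OF I]) (use g in simp)
    from nn_integral_Minkowski[OF this r]
    have "ennpowr (\<integral>\<^sup>+i. ennpowr (\<integral>\<^sup>+x. ennpowr (g i x) P \<partial>lborel) r \<partial>count_space I) (1 / r)
      \<le> (\<integral>\<^sup>+x. ennpowr (\<integral>\<^sup>+i. ennpowr (ennpowr (g i x) P) r \<partial>count_space I) (1 / r) \<partial>lborel)" .
    from ennpowr_mono[OF _ this, of "1 / P"] show ?thesis
      using P Q by (simp add: r_def Lp_norm_ennreal lq_norm_ennreal ennpowr_ennpowr)
  qed
  show ?thesis
  proof (cases "p \<le> q")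
    case True
    then show ?thesis using * by (simp add: max_absorb2)
  next
    case False
    have "lq_norm p I (\<lambda>i. Lp_norm p (g i)) \<le> Lp_norm p (\<lambda>x. lq_norm p I (\<lambda>i. g i x))"
      using *[of p] by simp
    also have "\<dots> \<le> Lp_norm p (\<lambda>x. lq_norm q I (\<lambda>i. g i x))"
      using False p q by (intro Lp_norm_mono lq_norm_antimono) auto
    finally show ?thesis using False by (simp add: max_absorb1)
  qed
qed

section \<open>Convolution with Schwartz functions\<close>

lemma iter_deriv_append: "iter_deriv (us @ vs) f = iter_deriv us (iter_deriv vs f)"
  by (induction us) auto

text \<open>Iterated derivatives of f stay in the class P, by induction on the list of directions.
  So for each operation only first derivatives have to be computed, once a class closed under them
  is found.\<close>

lemma schwartz_coinduct:
  assumes "P f"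
    and diff: "\<And>f x. P f \<Longrightarrow> f differentiable (at x)"
    and decay: "\<And>f k. P f \<Longrightarrow> \<exists>B. \<forall>x. (1 + norm x) ^ k * cmod (f x) \<le> B"
    and deriv: "\<And>f b. P f \<Longrightarrow> b \<in> Basis \<Longrightarrow> P (\<lambda>x. frechet_derivative f (at x) b)"
  shows "schwartz f"
proof -
  have "P (iter_deriv vs f)" if "vs \<in> lists Basis" for vs
    using that by (induction vs) (auto intro: deriv assms(1))
  with diff decay show ?thesis
    unfolding schwartz_def smooth_def bdd_above_def by (simp add: image_iff)
qed

lemma schwartz_iter_deriv:
  assumes "schwartz f" "vs \<in> lists Basis"
  shows "schwartz (iter_deriv vs f)"
  using assms unfolding schwartz_def smooth_def
  by (simp flip: iter_deriv_append)

lemma schwartz_imp_smooth: "schwartz f \<Longrightarrow> smooth f"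
  by (simp add: schwartz_def)

lemma schwartz_frechet_derivative:
  "schwartz f \<Longrightarrow> b \<in> Basis \<Longrightarrow> schwartz (\<lambda>x. frechet_derivative f (at x) b)"
  using schwartz_iter_deriv[of f "[b]"] by simp

lemma schwartz_has_derivative:
  assumes "schwartz f"
  shows "(f has_derivative frechet_derivative f (at x)) (at x)"
proof -
  have "iter_deriv [] f differentiable (at x)"
    using assms unfolding schwartz_def smooth_def by blast
  then show ?thesis by (simp add: frechet_derivative_works)
qed

lemma schwartz_decay:
  assumes "schwartz f"
  obtains B where "\<And>x. (1 + norm x) ^ k * cmod (f x) \<le> B"
proof -
  have "bdd_above (range (\<lambda>x. (1 + norm x) ^ k * cmod (iter_deriv [] f x)))"
    using assms unfolding schwartz_def
    by (elim conjE) (drule spec, erule bspec, rule lists.Nil)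
  then show ?thesis using that by (auto simp: bdd_above_def)
qed

text \<open>
  By the chain rule, a partial derivative of \<open>g \<circ> A\<close> is only a linear combination of such pullbacks;
  their span is what is closed under differentiation.
\<close>

inductive pullback_span ::
    "('a::euclidean_space \<Rightarrow> 'b::euclidean_space) \<Rightarrow> ('a \<Rightarrow> complex) \<Rightarrow> bool" for A where
  pullback_span_base: "schwartz g \<Longrightarrow> pullback_span A (\<lambda>x. g (A x))"
| pullback_span_zero: "pullback_span A (\<lambda>x. 0)"
| pullback_span_add: "pullback_span A f \<Longrightarrow> pullback_span A g \<Longrightarrow> pullback_span A (\<lambda>x. f x + g x)"
| pullback_span_cmult: "pullback_span A f \<Longrightarrow> pullback_span A (\<lambda>x. c * f x)"

lemma pullback_span_sum:
  "finite S \<Longrightarrow> (\<And>s. s \<in> S \<Longrightarrow> pullback_span A (f s)) \<Longrightarrow> pullback_span A (\<lambda>x. \<Sum>s\<in>S. f s x)"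
  by (induction S rule: finite_induct) (auto intro: pullback_span.intros)

text \<open>The derivative L of A is the same at every point, so the chain rule produces constant
  coefficients and derivatives stay in the span. The hypothesis on K turns decay in A x into decay
  in x.\<close>

lemma schwartz_pullback_span:
  assumes f: "pullback_span A f"
    and A: "\<And>x. (A has_derivative L) (at x)"
    and K: "\<And>x. 1 + norm x \<le> K * (1 + norm (A x))"
  shows "schwartz f"
  using f
proof (rule schwartz_coinduct)
  \<comment> \<open>Both claims are proved in one induction, since the sum and product rules need
    the differentiability of the parts.\<close>
  have diff: "f differentiable (at x) \<and>
      (b \<in> Basis \<longrightarrow> pullback_span A (\<lambda>x. frechet_derivative f (at x) b))"
    if "pullback_span A f" for f b x
    using that
  proof (induction arbitrary: x)
    case (pullback_span_base g)
    have d: "((\<lambda>x. g (A x)) has_derivative (\<lambda>v. frechet_derivative g (at (A x)) (L v))) (at x)" for x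
      using diff_chain_at[OF A schwartz_has_derivative[OF pullback_span_base]]
      by (simp add: o_def)
    have "frechet_derivative g (at y) (L b)
        = (\<Sum>c\<in>Basis. of_real (L b \<bullet> c) * frechet_derivative g (at y) c)" for y
    proof -
      interpret linear "frechet_derivative g (at y)"
        using schwartz_has_derivative[OF pullback_span_base]
        by (rule has_derivative_linear)
      show ?thesis
        by (subst euclidean_representation[of "L b", symmetric])
          (simp only: sum scale scaleR_conv_of_real)
    qed
    then have "frechet_derivative (\<lambda>x. g (A x)) (at x) b
        = (\<Sum>c\<in>Basis. of_real (L b \<bullet> c) * frechet_derivative g (at (A x)) c)" for x
      using frechet_derivative_at[OF d[of x]] by metis
    then show ?case
      using d pullback_span_base
      by (auto simp: differentiable_def
          intro!: pullback_span_sum pullback_span_cmult schwartz_frechet_derivative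
            pullback_span.pullback_span_base[of "\<lambda>x. frechet_derivative g (at x) _"])
  next
    case pullback_span_zero
    then show ?case by (auto simp: frechet_derivative_const intro: pullback_span.intros)
  next
    case (pullback_span_add f g)
    then have d: "((\<lambda>x. f x + g x) has_derivative
        (\<lambda>v. frechet_derivative f (at x) v + frechet_derivative g (at x) v)) (at x)" for x
      by (intro has_derivative_add) (auto simp flip: frechet_derivative_works)
    then show ?case
      using pullback_span_add frechet_derivative_at[OF d, symmetric]
      by (auto simp: differentiable_def intro!: pullback_span.pullback_span_add)
  next
    case (pullback_span_cmult f c)
    then have d: "((\<lambda>x. c * f x) has_derivative (\<lambda>v. c * frechet_derivative f (at x) v)) (at x)" for x
      by (intro has_derivative_mult_right) (auto simp flip: frechet_derivative_works)
    then show ?case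
      using pullback_span_cmult frechet_derivative_at[OF d, symmetric]
      by (auto simp: differentiable_def intro!: pullback_span.pullback_span_cmult)
  qed
  then show "f differentiable (at x)" if "pullback_span A f" for f x
    using that by blast
  show "pullback_span A (\<lambda>x. frechet_derivative f (at x) b)"
    if "pullback_span A f" "b \<in> Basis" for f b
    using diff that by blast
  show "\<exists>B. \<forall>x. (1 + norm x) ^ k * cmod (f x) \<le> B" if "pullback_span A f" for f k
    using that
  proof induction
    case (pullback_span_base g)
    obtain B where B: "\<And>x. (1 + norm x) ^ k * cmod (g x) \<le> B"
      using schwartz_decay[OF pullback_span_base] by blast
    have K0: "0 < K"
      using K[of 0] by (simp add: zero_less_mult_iff add_pos_nonneg)
        (smt (verit) K norm_ge_zero mult_nonpos_nonneg)
    have "(1 + norm x) ^ k * cmod (g (A x)) \<le> K ^ k * B" for x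
    proof -
      have "(1 + norm x) ^ k * cmod (g (A x)) \<le> (K * (1 + norm (A x))) ^ k * cmod (g (A x))"
        by (intro mult_right_mono power_mono K) auto
      also have "\<dots> = K ^ k * ((1 + norm (A x)) ^ k * cmod (g (A x)))"
        by (simp add: power_mult_distrib)
      also have "\<dots> \<le> K ^ k * B"
        using K0 by (intro mult_left_mono B) auto
      finally show ?thesis .
    qed
    then show ?case by blast
  next
    case pullback_span_zero
    then show ?case by auto
  next
    case (pullback_span_add f g)
    then obtain B C where BC: "\<And>x. (1 + norm x) ^ k * cmod (f x) \<le> B"
      "\<And>x. (1 + norm x) ^ k * cmod (g x) \<le> C" by blast
    have "(1 + norm x) ^ k * cmod (f x + g x) \<le> B + C" for x
    proof -
      have "(1 + norm x) ^ k * cmod (f x + g x) \<le> (1 + norm x) ^ k * (cmod (f x) + cmod (g x))"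
        by (intro mult_left_mono norm_triangle_ineq) auto
      also have "\<dots> \<le> B + C" using BC by (auto simp: distrib_left intro: add_mono)
      finally show ?thesis .
    qed
    then show ?case by blast
  next
    case (pullback_span_cmult f c)
    then obtain B where B: "\<And>x. (1 + norm x) ^ k * cmod (f x) \<le> B" by blast
    have "(1 + norm x) ^ k * cmod (c * f x) \<le> cmod c * B" for x
      using mult_left_mono[OF B[of x], of "cmod c"] by (simp add: norm_mult mult_ac)
    then show ?case by blast
  qed
qed

lemma schwartz_cmult:
  assumes "schwartz f"
  shows "schwartz (\<lambda>x. c * f x)"
  using pullback_span_cmult[OF pullback_span_base[OF assms, of "\<lambda>x. x"]]
  by (rule schwartz_pullback_span[where K = 1 and L = "\<lambda>x. x"]) auto

lemma schwartz_reflect: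
  assumes "schwartz f"
  shows "schwartz (\<lambda>y. f (x - y))"
proof (rule schwartz_pullback_span[OF pullback_span_base[OF assms]])
  show "((\<lambda>y. x - y) has_derivative uminus) (at y)" for y
    by (auto intro!: derivative_eq_intros)
  \<comment> \<open>A Peetre-type inequality; the constant may depend on x, which is fixed
    here.\<close>
  show "1 + norm y \<le> (1 + norm x) * (1 + norm (x - y))" for y
  proof -
    have "1 + norm y \<le> 1 + norm x + norm (x - y)"
      using norm_triangle_ineq4[of x "x - y"] by simp
    also have "\<dots> \<le> (1 + norm x) * (1 + norm (x - y))"
      by (simp add: algebra_simps)
    finally show ?thesis .
  qed
qed

text \<open>Conjugation is not complex linear and not a pullback, so the coinduction uses the class
  of conjugates of Schwartz functions instead of a span.\<close>

lemma schwartz_cnj: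
  assumes "schwartz f"
  shows "schwartz (\<lambda>x. cnj (f x))"
proof (rule schwartz_coinduct[where P = "\<lambda>h. \<exists>g. schwartz g \<and> h = (\<lambda>x. cnj (g x))"])
  show "\<exists>g. schwartz g \<and> (\<lambda>x. cnj (f x)) = (\<lambda>x. cnj (g x))"
    using assms by blast
  have d: "((\<lambda>x. cnj (g x)) has_derivative (\<lambda>v. cnj (frechet_derivative g (at x) v))) (at x)"
    if "schwartz g" for g :: "'a \<Rightarrow> complex" and x
    by (intro has_derivative_cnj schwartz_has_derivative that)
  show "h differentiable (at x)" if "\<exists>g. schwartz g \<and> h = (\<lambda>x. cnj (g x))"
    for h :: "'a \<Rightarrow> complex" and x
    using that d by (auto simp: differentiable_def)
  show "\<exists>g. schwartz g \<and> (\<lambda>x. frechet_derivative h (at x) b) = (\<lambda>x. cnj (g x))"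
    if h: "\<exists>g. schwartz g \<and> h = (\<lambda>x. cnj (g x))" and b: "b \<in> Basis" for h :: "'a \<Rightarrow> complex" and b
  proof -
    obtain g where g: "schwartz g" "h = (\<lambda>x. cnj (g x))"
      using h by blast
    have "frechet_derivative h (at x) b = cnj (frechet_derivative g (at x) b)" for x
      using frechet_derivative_at[OF d[OF g(1), of x], symmetric] g(2) by simp
    then show ?thesis
      using schwartz_frechet_derivative[OF g(1) b] by auto
  qed
  show "\<exists>B. \<forall>x. (1 + norm x) ^ k * cmod (h x) \<le> B" if "\<exists>g. schwartz g \<and> h = (\<lambda>x. cnj (g x))"
    for h :: "'a \<Rightarrow> complex" and k
    using that schwartz_decay by (metis complex_mod_cnj)
qed

lemma schwartz_refl_conj: "schwartz f \<Longrightarrow> schwartz (refl_conj f)"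
  using schwartz_cnj[OF schwartz_reflect[of f 0]] by (simp add: refl_conj_def [abs_def])

text \<open>Stated for every matrix, so that it applies to the shearlet matrices without computing
  their determinants. For invertible M the decay transfers by x = M (M^(-1) x) and a bound K for the
  operator norm of M.\<close>

lemma schwartz_dilate:
  assumes "schwartz f"
  shows "schwartz (dilate M f)"
proof (cases "invertible M")
  case True
  obtain K where K: "\<And>x. norm (M *v x) \<le> norm x * K" "0 < K"
    using bounded_linear.pos_bounded[OF matrix_vector_mul_bounded_linear[of M]] by blast
  have "schwartz (\<lambda>x. f (matrix_inv M *v x))"
  proof (rule schwartz_pullback_span[OF pullback_span_base[OF assms]])
    show "((*v) (matrix_inv M) has_derivative (*v) (matrix_inv M)) (at x)" for x
      by (rule bounded_linear_imp_has_derivative) (rule matrix_vector_mul_bounded_linear)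
    show "1 + norm x \<le> (1 + K) * (1 + norm (matrix_inv M *v x))" for x
    proof -
      have "M ** matrix_inv M = mat 1"
        using someI_ex[OF True[unfolded invertible_def]] by (simp add: matrix_inv_def)
      then have "M *v (matrix_inv M *v x) = x"
        by (simp add: matrix_vector_mul_assoc)
      then have "norm x \<le> norm (matrix_inv M *v x) * K"
        using K(1)[of "matrix_inv M *v x"] by simp
      then show ?thesis using K(2) norm_ge_zero[of "matrix_inv M *v x"]
        by (simp add: algebra_simps add_increasing)
    qed
  qed
  from schwartz_cmult[OF this] show ?thesis
    by (simp add: dilate_def [abs_def])
next
  case False
  \<comment> \<open>then \<open>inverse \<bar>det M\<bar> = 0\<close>\<close>
  then have "dilate M f = (\<lambda>x. 0 * f x)"
    by (simp add: invertible_det_nz dilate_def [abs_def])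
  then show ?thesis using schwartz_cmult[OF assms, of 0] by metis
qed

section \<open>Continuity of translation on the Schwartz space\<close>

lemma iter_deriv_has_derivative:
  "smooth f \<Longrightarrow> vs \<in> lists Basis \<Longrightarrow>
    (iter_deriv vs f has_derivative frechet_derivative (iter_deriv vs f) (at x)) (at x)"
  by (simp add: smooth_def flip: frechet_derivative_works)

lemma iter_deriv_diff:
  assumes "smooth f" "smooth g" "vs \<in> lists Basis"
  shows "iter_deriv vs (\<lambda>x. f x - g x) = (\<lambda>x. iter_deriv vs f x - iter_deriv vs g x)"
  using assms(3)
proof (induction vs)
  case (Cons v vs)
  have "frechet_derivative (\<lambda>x. iter_deriv vs f x - iter_deriv vs g x) (at x)
      = (\<lambda>v. frechet_derivative (iter_deriv vs f) (at x) v
           - frechet_derivative (iter_deriv vs g) (at x) v)" for x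
    using Cons assms(1,2)
    by (intro frechet_derivative_at [symmetric] has_derivative_diff iter_deriv_has_derivative) auto
  with Cons show ?case by simp
qed simp

text \<open>Each differentiation brings a factor -1 from the inner function; these signs disappear
  in the seminorms.\<close>

lemma iter_deriv_reflect:
  assumes "smooth f" "vs \<in> lists Basis"
  shows "iter_deriv vs (\<lambda>y. f (x - y)) = (\<lambda>y. (-1) ^ length vs * iter_deriv vs f (x - y))"
  using assms(2)
proof (induction vs)
  case (Cons v vs)
  have "((\<lambda>y. (-1) ^ length vs * iter_deriv vs f (x - y)) has_derivative
      (\<lambda>v. (-1) ^ length vs * frechet_derivative (iter_deriv vs f) (at (x - y)) (- v))) (at y)" for y
  proof (rule has_derivative_mult_right)
    have "((\<lambda>y. x - y) has_derivative uminus) (at y)"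
      by (auto intro!: derivative_eq_intros)
    from diff_chain_at[OF this iter_deriv_has_derivative[OF assms(1), of vs]] Cons
    show "((\<lambda>y. iter_deriv vs f (x - y)) has_derivative
        (\<lambda>v. frechet_derivative (iter_deriv vs f) (at (x - y)) (- v))) (at y)"
      by (simp add: o_def)
  qed
  from frechet_derivative_at[OF this, symmetric]
  have "frechet_derivative (iter_deriv vs (\<lambda>y. f (x - y))) (at y) v
      = (-1) ^ length vs * frechet_derivative (iter_deriv vs f) (at (x - y)) (- v)" for y
    using Cons by simp
  moreover have "frechet_derivative (iter_deriv vs f) (at z) (- v)
      = - frechet_derivative (iter_deriv vs f) (at z) v" for z
    using iter_deriv_has_derivative[OF assms(1), of vs] Cons
    by (intro linear_neg has_derivative_linear) auto
  ultimately show ?case by simp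
qed simp

text \<open>The mean value inequality on the unit ball around z. For x in that ball 1 + |z| \<le> 2
  (1 + |x|), so moving the weight from z to x costs the factor 2^k.\<close>

lemma schwartz_translation:
  assumes "schwartz g"
  obtains C where "C \<ge> 0"
    "\<And>z w. norm (w - z) \<le> 1 \<Longrightarrow> (1 + norm z) ^ k * cmod (g w - g z) \<le> C * norm (w - z)"
proof -
  have "\<exists>B. \<forall>x. (1 + norm x) ^ k * cmod (frechet_derivative g (at x) b) \<le> B" if "b \<in> Basis" for b
    using schwartz_decay[OF schwartz_frechet_derivative[OF assms that], of k] by metis
  then obtain B where B: "\<And>b x. b \<in> Basis \<Longrightarrow>
      (1 + norm x) ^ k * cmod (frechet_derivative g (at x) b) \<le> B b"
    by metis
  have B0: "0 \<le> B b" if "b \<in> Basis" for b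
    using B[OF that, of 0] by (simp add: order_trans[OF norm_ge_zero])
  \<comment> \<open>The operator norm is at most the sum of the moduli of the partial derivatives,
    so their decay bounds add up.\<close>
  have on: "(1 + norm x) ^ k * onorm (frechet_derivative g (at x)) \<le> sum B Basis" for x
  proof -
    have lin: "linear (frechet_derivative g (at x))"
      using schwartz_has_derivative[OF assms] by (rule has_derivative_linear)
    have "onorm (frechet_derivative g (at x)) \<le> (\<Sum>b\<in>Basis. cmod (frechet_derivative g (at x) b))"
    proof (rule onorm_le)
      fix v :: 'a
      have "frechet_derivative g (at x) v
          = (\<Sum>b\<in>Basis. (v \<bullet> b) *\<^sub>R frechet_derivative g (at x) b)"
        using lin by (subst euclidean_representation[of v, symmetric])
          (simp only: linear_sum linear_scale)
      also have "cmod \<dots> \<le> (\<Sum>b\<in>Basis. \<bar>v \<bullet> b\<bar> * cmod (frechet_derivative g (at x) b))"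
        by (rule order_trans[OF norm_sum]) simp
      also have "\<dots> \<le> (\<Sum>b\<in>Basis. norm v * cmod (frechet_derivative g (at x) b))"
        by (intro sum_mono mult_right_mono Basis_le_norm) auto
      finally show "cmod (frechet_derivative g (at x) v)
          \<le> (\<Sum>b\<in>Basis. cmod (frechet_derivative g (at x) b)) * norm v"
        by (simp add: mult.commute flip: sum_distrib_left)
    qed
    then have "(1 + norm x) ^ k * onorm (frechet_derivative g (at x))
        \<le> (\<Sum>b\<in>Basis. (1 + norm x) ^ k * cmod (frechet_derivative g (at x) b))"
      by (simp add: mult_left_mono flip: sum_distrib_left)
    also have "\<dots> \<le> sum B Basis"
      by (intro sum_mono B)
    finally show ?thesis .
  qed
  show ?thesis
  proof
    show "0 \<le> 2 ^ k * sum B Basis"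
      using B0 by (simp add: sum_nonneg)
    fix z w :: 'a
    assume wz: "norm (w - z) \<le> 1"
    have "cmod (g w - g z) \<le> (2 ^ k * sum B Basis / (1 + norm z) ^ k) * norm (w - z)"
    proof (rule differentiable_bound[of "cball z 1"])
      fix x assume "x \<in> cball z 1"
      then have "norm (z - x) \<le> 1"
        by (simp add: dist_norm)
      then have "1 + norm z \<le> 2 * (1 + norm x)"
        using norm_triangle_ineq2[of z x] norm_ge_zero[of x]
        by (smt (verit))
      then have "(1 + norm z) ^ k \<le> 2 ^ k * (1 + norm x) ^ k"
        by (metis power_mono power_mult_distrib add_nonneg_nonneg norm_ge_zero zero_le_one)
      moreover have "0 \<le> onorm (frechet_derivative g (at x))"
        using schwartz_has_derivative[OF assms] by (intro onorm_pos_le has_derivative_bounded_linear)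
      ultimately have "(1 + norm z) ^ k * onorm (frechet_derivative g (at x))
          \<le> 2 ^ k * ((1 + norm x) ^ k * onorm (frechet_derivative g (at x)))"
        by (simp add: mult_right_mono flip: mult.assoc)
      also have "\<dots> \<le> 2 ^ k * sum B Basis"
        by (intro mult_left_mono on) auto
      finally show "onorm (frechet_derivative g (at x)) \<le> 2 ^ k * sum B Basis / (1 + norm z) ^ k"
        by (simp add: pos_le_divide_eq add_pos_nonneg mult.commute)
    qed (use wz schwartz_has_derivative[OF assms] in
        \<open>auto simp: dist_norm norm_minus_commute intro: has_derivative_at_withinI\<close>)
    from mult_left_mono[OF this, of "(1 + norm z) ^ k"]
    show "(1 + norm z) ^ k * cmod (g w - g z) \<le> 2 ^ k * sum B Basis * norm (w - z)"
      by (simp add: add_pos_nonneg less_imp_neq[symmetric])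
  qed
qed

text \<open>\<open>schwartz_translation\<close> is applied to each iterated derivative of f at the
  points X n - y and x - y. The seminorm carries the weight at y, which is moved to x - y at the
  price of (1 + |x|)^k, uniformly in y.\<close>

lemma schwartz_tendsto_reflect:
  assumes f: "schwartz f" and X: "X \<longlonglongrightarrow> x"
  shows "schwartz_tendsto (\<lambda>n y. f (X n - y)) (\<lambda>y. f (x - y))"
  unfolding schwartz_tendsto_def
proof (intro allI ballI)
  fix k :: nat and vs :: "'a list"
  assume vs: "vs \<in> lists Basis"
  define g where "g = iter_deriv vs f"
  obtain C where C: "C \<ge> 0"
    "\<And>z w. norm (w - z) \<le> 1 \<Longrightarrow> (1 + norm z) ^ k * cmod (g w - g z) \<le> C * norm (w - z)"
    using schwartz_translation[OF schwartz_iter_deriv[OF f vs], folded g_def] by metis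
  have eq: "cmod (iter_deriv vs (\<lambda>y. f (X n - y) - f (x - y)) y) = cmod (g (X n - y) - g (x - y))"
    for n y
  proof -
    have "iter_deriv vs (\<lambda>y. f (X n - y) - f (x - y)) y
        = (-1) ^ length vs * (g (X n - y) - g (x - y))"
      using f vs by (simp add: g_def iter_deriv_diff iter_deriv_reflect schwartz_reflect
          schwartz_imp_smooth right_diff_distrib)
    then show ?thesis by (simp add: norm_mult norm_power)
  qed
  have le: "(1 + norm y) ^ k * cmod (iter_deriv vs (\<lambda>y. f (X n - y) - f (x - y)) y)
      \<le> (1 + norm x) ^ k * C * norm (X n - x)" if "norm (X n - x) \<le> 1" for n y
  proof -
    have "1 + norm y \<le> 1 + norm x + norm (x - y)"
      using norm_triangle_ineq4[of x "x - y"] by simp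
    also have "\<dots> \<le> (1 + norm x) * (1 + norm (x - y))"
      by (simp add: algebra_simps)
    finally have "(1 + norm y) ^ k \<le> (1 + norm x) ^ k * (1 + norm (x - y)) ^ k"
      by (metis power_mono power_mult_distrib add_nonneg_nonneg norm_ge_zero zero_le_one)
    then have "(1 + norm y) ^ k * cmod (g (X n - y) - g (x - y))
        \<le> (1 + norm x) ^ k * ((1 + norm (x - y)) ^ k * cmod (g (X n - y) - g (x - y)))"
      by (simp add: mult_right_mono flip: mult.assoc)
    also have "\<dots> \<le> (1 + norm x) ^ k * (C * norm (X n - x))"
      using C(2)[of "X n - y" "x - y"] that by (intro mult_left_mono) auto
    finally show ?thesis by (simp add: eq mult.assoc)
  qed
  have X0: "(\<lambda>n. norm (X n - x)) \<longlonglongrightarrow> 0"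
    using X by (simp add: LIM_zero tendsto_norm_zero)
  then have ev: "\<forall>\<^sub>F n in sequentially. norm (X n - x) < 1"
    by (rule order_tendstoD) simp
  show "(\<lambda>n. schwartz_seminorm k vs (\<lambda>y. f (X n - y) - f (x - y))) \<longlonglongrightarrow> 0"
  proof (rule tendsto_sandwich)
    show "\<forall>\<^sub>F n in sequentially. schwartz_seminorm k vs (\<lambda>y. f (X n - y) - f (x - y))
        \<le> (1 + norm x) ^ k * C * norm (X n - x)"
      using ev unfolding schwartz_seminorm_def
      by eventually_elim (intro cSUP_least, auto intro!: le)
    \<comment> \<open>A supremum of reals is meaningful only for a bounded set, so nonnegativity is
      shown for those n at which the bound \<open>le\<close> is available.\<close>
    show "\<forall>\<^sub>F n in sequentially. 0 \<le> schwartz_seminorm k vs (\<lambda>y. f (X n - y) - f (x - y))"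
      using ev
    proof eventually_elim
      case (elim n)
      have "bdd_above (range (\<lambda>y. (1 + norm y) ^ k
          * cmod (iter_deriv vs (\<lambda>y. f (X n - y) - f (x - y)) y)))"
        using le[of n] elim by (auto simp: bdd_above_def)
      then show ?case
        unfolding schwartz_seminorm_def by (rule cSUP_upper2[of _ _ 0]) auto
    qed
    show "(\<lambda>n. (1 + norm x) ^ k * C * norm (X n - x)) \<longlonglongrightarrow> 0"
      using tendsto_mult_right_zero[OF X0] .
  qed simp
qed

text \<open>Tempered distributions are sequentially continuous by definition, and X n tending to x
  makes the reflected translates converge in the Schwartz space.\<close>

lemma continuous_dconv:
  assumes "f \<in> tempered" "schwartz \<phi>"
  shows "continuous_on UNIV (dconv f \<phi>)"
  unfolding continuous_on_sequentially o_def dconv_def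
  using assms schwartz_reflect[OF assms(2)] schwartz_tendsto_reflect[OF assms(2)]
  by (auto simp: tempered_def)

section \<open>Embeddings\<close>

text \<open>Since C is a finite constant, one estimate on all tempered distributions yields both the
  inclusion of the spaces and the norm bound.\<close>

lemma embedsI:
  assumes "\<And>f. f \<in> tempered \<Longrightarrow> NY f \<le> ennreal C * NX f"
  shows "NX \<hookrightarrow> NY"
proof -
  have "NY f < \<infinity>" if "f \<in> tempered" "NX f < \<infinity>" for f
    using that(2) by (intro le_less_trans[OF assms[OF that(1)]]) (simp add: ennreal_mult_less_top)
  with assms show ?thesis
    unfolding embeds_def qn_space_def by blast
qed

lemma embedsI_le: "(\<And>f. f \<in> tempered \<Longrightarrow> NY f \<le> NX f) \<Longrightarrow> NX \<hookrightarrow> NY"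
  by (rule embedsI[of _ 1]) simp

section \<open>Number of shearlets per scale and summability of the weights\<close>

definition shearlet_scale :: "'n::finite \<times> nat \<times> (int^'n) \<Rightarrow> nat" where
  "shearlet_scale = (\<lambda>(dd, j, l). j)"

definition shearlet_level :: "nat \<Rightarrow> ('n::finite \<times> nat \<times> (int^'n)) set" where
  "shearlet_level j = {i \<in> shearlet_index. shearlet_scale i = j}"

text \<open>At scale j there are CARD('n) directions, and each of the CARD('n) - 1 free shear
  entries takes 2 * 2^j + 1 \<le> 3 * 2^j values.\<close>

lemma shearlet_level_card:
  "finite (shearlet_level j :: ('n::finite \<times> nat \<times> (int^'n)) set)" (is "finite ?S")
  "card (shearlet_level j :: ('n::finite \<times> nat \<times> (int^'n)) set)
    \<le> CARD('n) * (3 * 2 ^ j) ^ (CARD('n) - 1)"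
proof -
  \<comment> \<open>D records the direction and the free entries as an extensional function; F puts
    the forced 0 back at position dd.\<close>
  define D where "D = (SIGMA dd : (UNIV :: 'n set). (UNIV - {dd}) \<rightarrow>\<^sub>E {- (2 ^ j) .. (2 ^ j :: int)})"
  define F where "F = (\<lambda>(dd :: 'n, m). (dd, j, (\<chi> i. if i = dd then (0::int) else m i)))"
  have sub: "?S \<subseteq> F ` D"
  proof
    fix i :: "'n \<times> nat \<times> (int^'n)"
    assume "i \<in> ?S"
    then obtain dd l where i: "i = (dd, j, l)" "l $ dd = 0" "\<And>k. \<bar>l $ k\<bar> \<le> 2 ^ j"
      by (cases i) (auto simp: shearlet_level_def shearlet_index_def shearlet_scale_def)
    have "(dd, restrict (($) l) (UNIV - {dd})) \<in> D"
      using i(3) unfolding D_def by (auto simp: abs_le_iff minus_le_iff)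
    moreover have "i = F (dd, restrict (($) l) (UNIV - {dd}))"
      using i(1,2) by (simp add: F_def vec_eq_iff)
    ultimately show "i \<in> F ` D" by blast
  qed
  have fin: "finite D"
    unfolding D_def by (intro finite_SigmaI finite_PiE) auto
  show "finite ?S"
    using finite_subset[OF sub] fin by blast
  have "card ?S \<le> card D"
    using card_mono[OF finite_imageI[OF fin] sub] card_image_le[OF fin, of F] by linarith
  also have "card D = CARD('n) * nat (2 * 2 ^ j + 1) ^ (CARD('n) - 1)"
    unfolding D_def
    by (subst card_SigmaI) (auto intro!: finite_PiE simp: card_PiE card_Diff_singleton)
  also have "\<dots> \<le> CARD('n) * (3 * 2 ^ j) ^ (CARD('n) - 1)"
  proof (intro mult_left_mono power_mono)
    have "2 * 2 ^ j + 1 \<le> (3 * 2 ^ j :: int)" by simp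
    then show "nat (2 * 2 ^ j + 1) \<le> 3 * 2 ^ j"
      by (simp add: nat_le_iff)
  qed auto
  finally show "card ?S \<le> CARD('n) * (3 * 2 ^ j) ^ (CARD('n) - 1)" .
qed

text \<open>Grouping by scale: each index lies in exactly one level, and nonnegative sums may be
  interchanged.\<close>

lemma nn_integral_shearlet_scale:
  "(\<integral>\<^sup>+i. u (shearlet_scale i) \<partial>count_space (shearlet_index :: ('n::finite \<times> nat \<times> (int^'n)) set))
    = (\<Sum>j. u j * ennreal (card (shearlet_level j :: ('n \<times> nat \<times> (int^'n)) set)))"
proof -
  let ?I = "shearlet_index :: ('n \<times> nat \<times> (int^'n)) set"
  have "(\<integral>\<^sup>+i. u (shearlet_scale i) \<partial>count_space ?I)
      = (\<integral>\<^sup>+i. (\<Sum>j. u j * indicator (shearlet_level j) i) \<partial>count_space ?I)"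
  proof (intro nn_integral_cong)
    fix i assume "i \<in> space (count_space ?I)"
    then have "u j * indicator (shearlet_level j) i = (if j = shearlet_scale i then u j else 0)" for j
      by (auto simp: shearlet_level_def indicator_def)
    then show "u (shearlet_scale i) = (\<Sum>j. u j * indicator (shearlet_level j) i)"
      using sums_unique[OF sums_single[of "shearlet_scale i" u]] by simp
  qed
  also have "\<dots> = (\<Sum>j. \<integral>\<^sup>+i. u j * indicator (shearlet_level j) i \<partial>count_space ?I)"
    by (intro nn_integral_suminf) simp
  also have "\<dots> = (\<Sum>j. u j * ennreal (card (shearlet_level j :: ('n \<times> nat \<times> (int^'n)) set)))"
  proof (intro suminf_cong)
    fix j
    have "emeasure (count_space ?I) (shearlet_level j) = ennreal (card (shearlet_level j :: ('n \<times> nat \<times> (int^'n)) set))"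
      by (subst emeasure_count_space_finite)
        (auto simp: shearlet_level_card(1) ennreal_of_nat_eq_real_of_nat, simp add: shearlet_level_def)
    then show "(\<integral>\<^sup>+i. u j * indicator (shearlet_level j) i \<partial>count_space ?I)
        = u j * ennreal (card (shearlet_level j :: ('n \<times> nat \<times> (int^'n)) set))"
      by (subst nn_integral_cmult_indicator) (auto simp: shearlet_level_def)
  qed
  finally show ?thesis .
qed

text \<open>The count of each level bounds the sum by a geometric series whose ratio is 2 to the
  power CARD('n) - 1 - c, hence less than 1.\<close>

lemma nn_integral_shearlet_scale_finite:
  assumes c: "real CARD('n::finite) - 1 < c"
  shows "(\<integral>\<^sup>+i. ennreal (2 powr (- c * real (shearlet_scale i)))
    \<partial>count_space (shearlet_index :: ('n \<times> nat \<times> (int^'n)) set)) < top"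
proof -
  \<comment> \<open>Here \<open>d\<close> is the dimension minus one, the number of shear
    parameters.\<close>
  define d where "d = CARD('n) - 1"
  have d: "real d = real CARD('n) - 1"
    by (simp add: d_def of_nat_diff Suc_leI)
  define \<rho> where "\<rho> = 2 powr (real d - c)"
  have \<rho>: "0 < \<rho>" "\<rho> < 1"
    using c d by (auto simp: \<rho>_def powr_less_one)
  define K where "K = real CARD('n) * 3 ^ d"
  have term_le: "ennreal (2 powr (- c * real j)) * ennreal (card (shearlet_level j :: ('n \<times> nat \<times> (int^'n)) set))
      \<le> ennreal (K * \<rho> ^ j)" for j
  proof -
    have "real (card (shearlet_level j :: ('n \<times> nat \<times> (int^'n)) set))
        \<le> real (CARD('n) * (3 * 2 ^ j) ^ d)"
      unfolding of_nat_le_iff d_def by (rule shearlet_level_card)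
    also have "\<dots> = K * 2 powr (real d * real j)"
      by (simp add: K_def power_mult_distrib powr_realpow flip: power_mult of_nat_mult)
        (simp add: mult.commute)
    finally have "2 powr (- c * real j) * real (card (shearlet_level j :: ('n \<times> nat \<times> (int^'n)) set))
        \<le> 2 powr (- c * real j) * (K * 2 powr (real d * real j))"
      by (intro mult_left_mono) auto
    also have "\<dots> = K * (2 powr (- c * real j) * 2 powr (real d * real j))"
      by simp
    also have "\<dots> = K * \<rho> ^ j"
      by (simp add: \<rho>_def powr_power algebra_simps flip: powr_add)
    finally show ?thesis
      by (simp flip: ennreal_mult add: ennreal_leI)
  qed
  have "(\<Sum>j. ennreal (2 powr (- c * real j)) * ennreal (card (shearlet_level j :: ('n \<times> nat \<times> (int^'n)) set)))
      \<le> (\<Sum>j. ennreal (K * \<rho> ^ j))"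
    by (intro suminf_le term_le) auto
  also have "\<dots> < top"
    using \<rho> by (subst less_top [symmetric])
      (intro ennreal_suminf_neq_top summable_mult summable_geometric, auto simp: K_def)
  finally show ?thesis
    by (simp only: nn_integral_shearlet_scale[of "\<lambda>j. ennreal (2 powr (- c * real j))"])
qed

lemma lq_norm_scale_weight_finite:
  assumes q0: "0 < q0"
    and \<epsilon>: "ennreal (real CARD('n::finite) - 1) / (ennreal (real CARD('n) + 1) * q0) < ennreal \<epsilon>"
  shows "lq_norm q0 (shearlet_index :: ('n \<times> nat \<times> (int^'n)) set)
    (\<lambda>i. ennreal (Q_measure TYPE('n) (shearlet_scale i) powr \<epsilon>)) < top"
proof (cases "q0 = \<infinity>")
  case True
  \<comment> \<open>For q0 = \<infinity> the hypothesis amounts to \<epsilon> > 0, and then no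
    weight exceeds 1.\<close>
  have "0 < \<epsilon>"
    using \<epsilon> by (metis ennreal_less_zero_iff le_less_trans zero_le)
  then have "(Q_measure TYPE('n) j powr \<epsilon>) \<le> 1" for j
    unfolding Q_measure_def powr_powr
    using powr_mono[of "- (real CARD('n) + 1) * real j * \<epsilon>" 0 2]
    by (simp add: mult_nonpos_nonneg)
  then have "(SUP i\<in>(shearlet_index :: ('n \<times> nat \<times> (int^'n)) set).
      ennreal (Q_measure TYPE('n) (shearlet_scale i) powr \<epsilon>)) \<le> 1"
    by (intro SUP_least) simp
  then show ?thesis using True by (simp add: le_less_trans)
next
  case False
  then obtain Q where Q: "q0 = ennreal Q" "Q > 0"
    using q0 by (elim ennreal_pos_finite_cases) (auto simp: top.not_eq_extremum)
  have d: "real CARD('n) \<ge> 1" by (simp add: Suc_leI)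
  have "(real CARD('n) - 1) / ((real CARD('n) + 1) * Q) < \<epsilon>"
  proof -
    have "ennreal (real CARD('n) - 1) / (ennreal (real CARD('n) + 1) * q0)
        = ennreal ((real CARD('n) - 1) / ((real CARD('n) + 1) * Q))"
      unfolding Q(1) using d Q(2)
      by (subst ennreal_mult [symmetric]) (auto intro!: divide_ennreal mult_pos_pos)
    with \<epsilon> show ?thesis
      using d Q(2) by (simp only:) (subst (asm) ennreal_less_iff, auto)
  qed
  \<comment> \<open>The Q-th power of the weight at scale j is 2^(-cj) with c = (CARD('n) + 1)
    \<epsilon> Q, and the hypothesis on \<epsilon> is exactly the convergence condition for this
    c.\<close>
  then have c: "real CARD('n) - 1 < (real CARD('n) + 1) * \<epsilon> * Q"
    using Q d by (subst (asm) pos_divide_less_eq) (auto simp: mult_ac)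
  have "ennpowr (ennreal (Q_measure TYPE('n) j powr \<epsilon>)) Q
      = ennreal (2 powr (- ((real CARD('n) + 1) * \<epsilon> * Q) * real j))" for j
  proof -
    have "- (real CARD('n) + 1) * real j * \<epsilon> * Q = - ((real CARD('n) + 1) * \<epsilon> * Q) * real j"
      by (simp add: algebra_simps)
    then show ?thesis by (simp only: Q_measure_def powr_powr ennpowr_simps powr_ge_zero)
  qed
  then have "(\<integral>\<^sup>+i. ennpowr (ennreal (Q_measure TYPE('n) (shearlet_scale i) powr \<epsilon>)) Q
      \<partial>count_space (shearlet_index :: ('n \<times> nat \<times> (int^'n)) set)) < top"
    using nn_integral_shearlet_scale_finite[OF c] by (simp only:)
  then show ?thesis
    using Q(2) unfolding Q(1) lq_norm_ennreal[OF Q(2)] top.not_eq_extremum[symmetric]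
    by (simp only: ennpowr_eq_top_iff not_False_eq_True)
qed

text \<open>Split the weight with exponent -s into those with exponents \<epsilon> and -(s +
  \<epsilon>). The second, times a_i, is at most its own l^q1 quasi-norm for every i, whatever q1
  is; what remains is the finite l^q0 quasi-norm of the first. So C is independent of the sequence
  a.\<close>

lemma lq_norm_weight_shift:
  fixes s \<epsilon> :: real
  assumes q0: "0 < q0" and q1: "0 < q1"
    and \<epsilon>: "ennreal (real CARD('n::finite) - 1) / (ennreal (real CARD('n) + 1) * q0) < ennreal \<epsilon>"
  obtains C where "C \<ge> 1"
    "\<And>a. lq_norm q0 (shearlet_index :: ('n \<times> nat \<times> (int^'n)) set)
        (\<lambda>i. ennreal (Q_measure TYPE('n) (shearlet_scale i) powr (- s)) * a i)
      \<le> ennreal C * lq_norm q1 shearlet_index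
        (\<lambda>i. ennreal (Q_measure TYPE('n) (shearlet_scale i) powr (- (s + \<epsilon>))) * a i)"
proof
  let ?I = "shearlet_index :: ('n \<times> nat \<times> (int^'n)) set"
  let ?w = "\<lambda>\<alpha> i. ennreal (Q_measure TYPE('n) (shearlet_scale (i :: 'n \<times> nat \<times> (int^'n))) powr \<alpha>)"
  define N where "N = lq_norm q0 ?I (?w \<epsilon>)"
  \<comment> \<open>The maximum with 1 supplies the constant that \<open>add_le_const_mult\<close>
    asks for.\<close>
  show "max 1 (enn2real N) \<ge> 1" by simp
  have N: "N \<le> ennreal (max 1 (enn2real N))"
    using lq_norm_scale_weight_finite[OF q0 \<epsilon>]
    by (metis N_def ennreal_enn2real ennreal_leI max.cobounded2)
  fix a
  let ?M = "lq_norm q1 ?I (\<lambda>i. ?w (- (s + \<epsilon>)) i * a i)"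
  have "?w (- s) i * a i \<le> ?M * ?w \<epsilon> i" if "i \<in> ?I" for i
  proof -
    have "?w (- s) i * a i = ?w \<epsilon> i * (?w (- (s + \<epsilon>)) i * a i)"
      by (simp flip: mult.assoc ennreal_mult powr_add)
    also have "\<dots> \<le> ?w \<epsilon> i * ?M"
      by (intro mult_left_mono le_lq_norm[OF q1 that]) auto
    finally show ?thesis by (simp add: mult.commute)
  qed
  then have "lq_norm q0 ?I (\<lambda>i. ?w (- s) i * a i) \<le> lq_norm q0 ?I (\<lambda>i. ?M * ?w \<epsilon> i)"
    by (intro lq_norm_mono[OF q0])
  also have "\<dots> = N * ?M"
    unfolding N_def lq_norm_cmult[OF q0] by (rule mult.commute)
  also have "\<dots> \<le> ennreal (max 1 (enn2real N)) * ?M"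
    by (intro mult_right_mono N) auto
  finally show "lq_norm q0 ?I (\<lambda>i. ?w (- s) i * a i) \<le> ennreal (max 1 (enn2real N)) * ?M" .
qed

section \<open>The quasi-norms as mixed norms of coefficients, and their embeddings\<close>

definition shearlet_coeff ::
    "('n::finite \<Rightarrow> real^'n \<Rightarrow> complex) \<Rightarrow> ((real^'n \<Rightarrow> complex) \<Rightarrow> complex) \<Rightarrow>
     'n \<times> nat \<times> (int^'n) \<Rightarrow> real^'n \<Rightarrow> ennreal" where
  "shearlet_coeff \<phi> f = (\<lambda>(dd, j, l) x.
     ennreal (cmod (dconv f (dilate (shearlet_mat dd j l) (\<phi> dd)) x)))"

lemma besov_norm_eq:
  fixes \<phi> :: "'n::finite \<Rightarrow> real^'n \<Rightarrow> complex"
  shows "besov_norm \<phi> \<Psi> \<alpha> p q f =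
     Lp_norm p (\<lambda>x. ennreal (cmod (dconv f \<Psi> x))) +
     lq_norm q shearlet_index (\<lambda>i.
       ennreal (Q_measure TYPE('n) (shearlet_scale i) powr (- \<alpha>)) * Lp_norm p (shearlet_coeff \<phi> f i))"
  by (simp add: besov_norm_def shearlet_scale_def shearlet_coeff_def case_prod_unfold)

lemma triebel_lizorkin_norm_eq:
  fixes \<phi> :: "'n::finite \<Rightarrow> real^'n \<Rightarrow> complex"
  shows "triebel_lizorkin_norm \<phi> \<Psi> \<alpha> p q f =
     Lp_norm p (\<lambda>x. ennreal (cmod (dconv f \<Psi> x))) +
     Lp_norm p (\<lambda>x. lq_norm q shearlet_index (\<lambda>i.
       ennreal (Q_measure TYPE('n) (shearlet_scale i) powr (- \<alpha>)) * shearlet_coeff \<phi> f i x))"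
  by (simp add: triebel_lizorkin_norm_def shearlet_scale_def shearlet_coeff_def case_prod_unfold)

lemma besov_embeds_antimono:
  assumes "0 < q1" "q1 \<le> q0"
  shows "besov_norm \<phi> \<Psi> s p q1 \<hookrightarrow> besov_norm \<phi> \<Psi> s p q0"
  unfolding besov_norm_eq
  by (intro embedsI_le add_left_mono lq_norm_antimono assms)

lemma triebel_lizorkin_embeds_antimono:
  assumes "0 < q1" "q1 \<le> q0" "0 < p" "p < \<infinity>"
  shows "triebel_lizorkin_norm \<phi> \<Psi> s p q1 \<hookrightarrow> triebel_lizorkin_norm \<phi> \<Psi> s p q0"
  unfolding triebel_lizorkin_norm_eq
  by (intro embedsI_le add_left_mono Lp_norm_mono lq_norm_antimono assms)

text \<open>In the applications a is the low-frequency term, common to both quasi-norms; C \<ge> 1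
  absorbs it.\<close>

lemma add_le_const_mult:
  fixes a b c :: ennreal
  assumes "C \<ge> 1" "b \<le> ennreal C * c"
  shows "a + b \<le> ennreal C * (a + c)"
proof -
  have "1 * a \<le> ennreal C * a"
    using assms(1) by (intro mult_right_mono) auto
  with assms(2) show ?thesis by (simp add: distrib_left add_mono)
qed

lemma besov_embeds_smoother:
  fixes \<phi> :: "'n::finite \<Rightarrow> real^'n \<Rightarrow> complex"
  assumes "0 < q0" "0 < q1"
    and "ennreal (real CARD('n) - 1) / (ennreal (real CARD('n) + 1) * q0) < ennreal \<epsilon>"
  shows "besov_norm \<phi> \<Psi> (s + \<epsilon>) p q1 \<hookrightarrow> besov_norm \<phi> \<Psi> s p q0"
proof -
  obtain C where C: "C \<ge> 1"
    "\<And>a. lq_norm q0 (shearlet_index :: ('n \<times> nat \<times> (int^'n)) set)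
        (\<lambda>i. ennreal (Q_measure TYPE('n) (shearlet_scale i) powr (- s)) * a i)
      \<le> ennreal C * lq_norm q1 shearlet_index
        (\<lambda>i. ennreal (Q_measure TYPE('n) (shearlet_scale i) powr (- (s + \<epsilon>))) * a i)"
    using lq_norm_weight_shift[OF assms] by blast
  show ?thesis
    unfolding besov_norm_eq by (intro embedsI[of _ C] add_le_const_mult C)
qed

text \<open>In the Besov case the weight estimate is applied once, to the sequence of L^p norms;
  here it is applied at every x. As C is the same for all x, it can be taken out of the L^p
  norm.\<close>

lemma triebel_lizorkin_embeds_smoother:
  fixes \<phi> :: "'n::finite \<Rightarrow> real^'n \<Rightarrow> complex"
  assumes "0 < q0" "0 < q1"
    and "ennreal (real CARD('n) - 1) / (ennreal (real CARD('n) + 1) * q0) < ennreal \<epsilon>"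
    and p: "0 < p" "p < \<infinity>"
  shows "triebel_lizorkin_norm \<phi> \<Psi> (s + \<epsilon>) p q1 \<hookrightarrow> triebel_lizorkin_norm \<phi> \<Psi> s p q0"
proof -
  obtain C where C: "C \<ge> 1"
    "\<And>a. lq_norm q0 (shearlet_index :: ('n \<times> nat \<times> (int^'n)) set)
        (\<lambda>i. ennreal (Q_measure TYPE('n) (shearlet_scale i) powr (- s)) * a i)
      \<le> ennreal C * lq_norm q1 shearlet_index
        (\<lambda>i. ennreal (Q_measure TYPE('n) (shearlet_scale i) powr (- (s + \<epsilon>))) * a i)"
    using lq_norm_weight_shift[OF assms(1-3)] by blast
  have C0: "C > 0" using C(1) by simp
  show ?thesis
    unfolding triebel_lizorkin_norm_eq
    by (intro embedsI[of _ C] add_le_const_mult C(1), subst Lp_norm_cmult[OF p C0, symmetric])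
      (intro Lp_norm_mono p C(2))
qed

lemma shearlet_coeff_measurable:
  assumes "f \<in> tempered" "\<And>dd. schwartz (\<phi> dd)"
  shows "shearlet_coeff \<phi> f i \<in> borel_measurable lborel"
proof -
  obtain dd j l where i: "i = (dd, j, l)" by (cases i)
  have "continuous_on UNIV (dconv f (dilate (shearlet_mat dd j l) (\<phi> dd)))"
    by (intro continuous_dconv schwartz_dilate assms)
  then have "dconv f (dilate (shearlet_mat dd j l) (\<phi> dd)) \<in> borel_measurable lborel"
    by (simp add: borel_measurable_continuous_onI)
  then show ?thesis by (simp add: i shearlet_coeff_def)
qed

text \<open>With the weight inside L^p, both quasi-norms are mixed norms of one family of functions,
  taken in opposite orders; this is the form in which the interchange inequalities apply.\<close>

lemma besov_norm_eq_weighted_coeff: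
  fixes \<phi> :: "'n::finite \<Rightarrow> real^'n \<Rightarrow> complex"
  assumes "0 < p" "p < \<infinity>"
  shows "besov_norm \<phi> \<Psi> \<alpha> p q f =
     Lp_norm p (\<lambda>x. ennreal (cmod (dconv f \<Psi> x))) +
     lq_norm q shearlet_index (\<lambda>i. Lp_norm p (\<lambda>x.
       ennreal (Q_measure TYPE('n) (shearlet_scale i) powr (- \<alpha>)) * shearlet_coeff \<phi> f i x))"
proof -
  have "Lp_norm p (\<lambda>x. ennreal (Q_measure TYPE('n) j powr (- \<alpha>)) * h x)
      = ennreal (Q_measure TYPE('n) j powr (- \<alpha>)) * Lp_norm p h" for j and h :: "real^'n \<Rightarrow> ennreal"
    by (rule Lp_norm_cmult[OF assms]) (simp add: Q_measure_def)
  then show ?thesis by (simp only: besov_norm_eq)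
qed

lemma besov_embeds_triebel_lizorkin:
  assumes \<phi>: "\<And>dd. schwartz (\<phi> dd)" and pq: "0 < p" "p < \<infinity>" "0 < q"
  shows "besov_norm \<phi> \<Psi> s p (min p q) \<hookrightarrow> triebel_lizorkin_norm \<phi> \<Psi> s p q"
  unfolding besov_norm_eq_weighted_coeff[OF pq(1,2)] triebel_lizorkin_norm_eq
  by (intro embedsI_le add_left_mono Lp_norm_lq_norm_le countableI_type borel_measurable_times_ennreal
      borel_measurable_const shearlet_coeff_measurable \<phi> pq)

lemma triebel_lizorkin_embeds_besov:
  assumes \<phi>: "\<And>dd. schwartz (\<phi> dd)" and pq: "0 < p" "p < \<infinity>" "0 < q"
  shows "triebel_lizorkin_norm \<phi> \<Psi> s p q \<hookrightarrow> besov_norm \<phi> \<Psi> s p (max p q)"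
  unfolding besov_norm_eq_weighted_coeff[OF pq(1,2)] triebel_lizorkin_norm_eq
  by (intro embedsI_le add_left_mono lq_norm_Lp_norm_le countableI_type borel_measurable_times_ennreal
      borel_measurable_const shearlet_coeff_measurable \<phi> pq)

theorem theorem7p1:
  fixes h1 h2 :: "real \<Rightarrow> complex"
    and \<psi> \<phi> :: "'n::finite \<Rightarrow> real^'n \<Rightarrow> complex"
    and \<Psi> :: "real^'n \<Rightarrow> complex"
    and s :: real
  assumes d: "CARD('n) \<ge> 2"
    and sys: "shearlet_system h1 h2 \<psi> \<Psi>"
    and \<phi>: "\<phi> = \<psi> \<or> \<phi> = (\<lambda>dd. refl_conj (\<psi> dd))"
  shows
    "(\<forall>q1 q0. 0 < q1 \<and> q1 \<le> q0 \<longrightarrow>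
        (\<forall>p>0. besov_norm \<phi> \<Psi> s p q1 \<hookrightarrow> besov_norm \<phi> \<Psi> s p q0) \<and>
        (\<forall>p. 0 < p \<and> p < \<infinity> \<longrightarrow>
           triebel_lizorkin_norm \<phi> \<Psi> s p q1 \<hookrightarrow> triebel_lizorkin_norm \<phi> \<Psi> s p q0)) \<and>
     (\<forall>q0 q1 (\<epsilon>::real). 0 < q0 \<and> 0 < q1 \<and>
          ennreal (real CARD('n) - 1) / (ennreal (real CARD('n) + 1) * q0) < ennreal \<epsilon> \<longrightarrow>
        (\<forall>p>0. besov_norm \<phi> \<Psi> (s + \<epsilon>) p q1 \<hookrightarrow> besov_norm \<phi> \<Psi> s p q0) \<and>
        (\<forall>p. 0 < p \<and> p < \<infinity> \<longrightarrow>
           triebel_lizorkin_norm \<phi> \<Psi> (s + \<epsilon>) p q1 \<hookrightarrow> triebel_lizorkin_norm \<phi> \<Psi> s p q0)) \<and>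
     (\<forall>p q. 0 < p \<and> p < \<infinity> \<and> 0 < q \<longrightarrow>
        besov_norm \<phi> \<Psi> s p (min p q) \<hookrightarrow> triebel_lizorkin_norm \<phi> \<Psi> s p q \<and>
        triebel_lizorkin_norm \<phi> \<Psi> s p q \<hookrightarrow> besov_norm \<phi> \<Psi> s p (max p q))"
proof -
  have "schwartz (\<psi> dd)" for dd
    using sys by (simp add: shearlet_system_def)
  \<comment> \<open>For either choice of the analysing family the functions are Schwartz, which
    gives the measurability of the coefficients in (iii).\<close>
  with \<phi> have schwartz: "schwartz (\<phi> dd)" for dd
    by (auto intro: schwartz_refl_conj)
  show ?thesis
  proof (intro conjI allI impI)
    fix q1 q0 p :: ennreal
    assume "0 < q1 \<and> q1 \<le> q0"
    then show "besov_norm \<phi> \<Psi> s p q1 \<hookrightarrow> besov_norm \<phi> \<Psi> s p q0"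
      by (intro besov_embeds_antimono) auto
  next
    fix q1 q0 p :: ennreal
    assume "0 < q1 \<and> q1 \<le> q0" "0 < p \<and> p < \<infinity>"
    then show "triebel_lizorkin_norm \<phi> \<Psi> s p q1 \<hookrightarrow> triebel_lizorkin_norm \<phi> \<Psi> s p q0"
      by (intro triebel_lizorkin_embeds_antimono) auto
  next
    fix q0 q1 p :: ennreal and \<epsilon> :: real
    assume "0 < q0 \<and> 0 < q1 \<and>
      ennreal (real CARD('n) - 1) / (ennreal (real CARD('n) + 1) * q0) < ennreal \<epsilon>"
    then show "besov_norm \<phi> \<Psi> (s + \<epsilon>) p q1 \<hookrightarrow> besov_norm \<phi> \<Psi> s p q0"
      by (intro besov_embeds_smoother) auto
  next
    fix q0 q1 p :: ennreal and \<epsilon> :: real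
    assume "0 < q0 \<and> 0 < q1 \<and>
      ennreal (real CARD('n) - 1) / (ennreal (real CARD('n) + 1) * q0) < ennreal \<epsilon>"
      "0 < p \<and> p < \<infinity>"
    then show "triebel_lizorkin_norm \<phi> \<Psi> (s + \<epsilon>) p q1 \<hookrightarrow> triebel_lizorkin_norm \<phi> \<Psi> s p q0"
      by (intro triebel_lizorkin_embeds_smoother) auto
  next
    fix p q :: ennreal
    assume "0 < p \<and> p < \<infinity> \<and> 0 < q"
    then show "besov_norm \<phi> \<Psi> s p (min p q) \<hookrightarrow> triebel_lizorkin_norm \<phi> \<Psi> s p q"
      and "triebel_lizorkin_norm \<phi> \<Psi> s p q \<hookrightarrow> besov_norm \<phi> \<Psi> s p (max p q)"
      by (auto intro: besov_embeds_triebel_lizorkin[of \<phi>, OF schwartz]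
          triebel_lizorkin_embeds_besov[of \<phi>, OF schwartz])
  qed
qed

end
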